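(* Let $n$ be an odd positive integer such that the radical of $n$ is a Burnside number. Let $G$ and $N$ be groups with $|G|=|N|=2n$ such that the pair $(G,N)$ is realizable. Then $G\cong\mathbb{Z}_n\rtimes_{\varphi}\mathbb{Z}_2$ for some homomorphism $\varphi:\mathbb{Z}_2\to\mathrm{Aut}(\mathbb{Z}_n)$ if and only if $N\cong\mathbb{Z}_n\rtimes_{\psi}\mathbb{Z}_2$ for some homomorphism $\psi:\mathbb{Z}_2\to\mathrm{Aut}(\mathbb{Z}_n)$.
   Context: $\mathbb{Z}_m$ denotes the cyclic group of order $m$. The radical of $n$ is the product of the distinct primes dividing $n$. A positive integer $m$ is a Burnside number if $\gcd(m,\phi(m))=1$, where $\phi$ is Euler's totient function (equivalently, every group of order $m$ is cyclic). For a group $N$, the holomorph is $\mathrm{Hol}(N)=N\rtimes\mathrm{Aut}(N)$, regarded as a group of permutations of $N$ via $(x,\alpha)\cdot y=x\,\alpha(y)$. A subgroup of $\mathrm{Hol}(N)$ is regular if it acts on $N$ transitively with trivial point stabilizers. For finite groups $G,N$ with $|G|=|N|$, the (ordered) pair $(G,N)$ is called realizable (Hopf-Galois realizable) if $\mathrm{Hol}(N)$ has a regular subgroup isomorphic to $G$. *)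

theory Defs
  imports "HOL-Algebra.Algebra" "HOL-Number_Theory.Totient"
begin

definition rad :: "nat \<Rightarrow> nat" where
  "rad n = \<Prod>(prime_factors n)"

definition burnside_number :: "nat \<Rightarrow> bool" where
  "burnside_number m \<longleftrightarrow> 0 < m \<and> coprime m (totient m)"

definition semidirect ::
  "('a, 'c) monoid_scheme \<Rightarrow> ('b, 'd) monoid_scheme \<Rightarrow> ('b \<Rightarrow> 'a \<Rightarrow> 'a) \<Rightarrow> ('a \<times> 'b) monoid" where
  "semidirect A B \<phi> =
     \<lparr>carrier = carrier A \<times> carrier B,
      monoid.mult = (\<lambda>(a, b) (a', b'). (a \<otimes>\<^bsub>A\<^esub> \<phi> b a', b \<otimes>\<^bsub>B\<^esub> b')),
      one = (\<one>\<^bsub>A\<^esub>, \<one>\<^bsub>B\<^esub>)\<rparr>"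

definition holomorph :: "('a, 'c) monoid_scheme \<Rightarrow> ('a \<times> ('a \<Rightarrow> 'a)) monoid" where
  "holomorph N = semidirect N (AutoGroup N) (\<lambda>\<alpha>. \<alpha>)"

text \<open>The restriction to the carrier makes the permutations elements of \<^const>\<open>BijGroup\<close>,
  whose members are extensional.\<close>

definition hol_action :: "('a, 'c) monoid_scheme \<Rightarrow> 'a \<times> ('a \<Rightarrow> 'a) \<Rightarrow> 'a \<Rightarrow> 'a" where
  "hol_action N = (\<lambda>(x, \<alpha>). \<lambda>y\<in>carrier N. x \<otimes>\<^bsub>N\<^esub> \<alpha> y)"

definition regular_subgroup :: "('a, 'c) monoid_scheme \<Rightarrow> ('a \<times> ('a \<Rightarrow> 'a)) set \<Rightarrow> bool" where
  "regular_subgroup N H \<longleftrightarrow>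
     subgroup H (holomorph N) \<and>
     transitive_action (holomorph N\<lparr>carrier := H\<rparr>) (carrier N) (hol_action N) \<and>
     (\<forall>x\<in>carrier N. stabilizer (holomorph N\<lparr>carrier := H\<rparr>) (hol_action N) x
                      = {\<one>\<^bsub>holomorph N\<^esub>})"

definition realizable :: "('a, 'c) monoid_scheme \<Rightarrow> ('b, 'd) monoid_scheme \<Rightarrow> bool" where
  "realizable G N \<longleftrightarrow> (\<exists>H. regular_subgroup N H \<and> G \<cong> holomorph N\<lparr>carrier := H\<rparr>)"

lemma group_semidirect:
  assumes "group A" "group B" and \<phi>: "\<phi> \<in> hom B (AutoGroup A)"
  shows "group (semidirect A B \<phi>)"
proof -
  interpret A: group A by fact
  interpret B: group B by fact
  interpret \<phi>: group_hom B "AutoGroup A" \<phi>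
    using A.AutoGroup B.is_group \<phi> by (simp add: group_hom_def group_hom_axioms_def)
  have aut: "\<phi> b \<in> auto A" if "b \<in> carrier B" for b
    using \<phi>.hom_closed[OF that] by (simp add: AutoGroup_def)
  have hm: "\<phi> b (x \<otimes>\<^bsub>A\<^esub> y) = \<phi> b x \<otimes>\<^bsub>A\<^esub> \<phi> b y"
    if "b \<in> carrier B" "x \<in> carrier A" "y \<in> carrier A" for b x y
    using aut[OF that(1)] that by (auto simp: auto_def hom_def)
  have cl: "\<phi> b x \<in> carrier A" if "b \<in> carrier B" "x \<in> carrier A" for b x
    using aut[OF that(1)] that by (auto simp: auto_def hom_def)
  have mlt: "\<phi> (b \<otimes>\<^bsub>B\<^esub> c) x = \<phi> b (\<phi> c x)"
    if "b \<in> carrier B" "c \<in> carrier B" "x \<in> carrier A" for b c x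
    using \<phi>.hom_mult[OF that(1,2)] aut[OF that(1)] aut[OF that(2)] that(3)
    by (simp add: AutoGroup_def BijGroup_def auto_def compose_def)
  have one: "\<phi> \<one>\<^bsub>B\<^esub> x = x" if "x \<in> carrier A" for x
    using \<phi>.hom_one that by (simp add: AutoGroup_def BijGroup_def)
  show ?thesis
  proof (rule groupI)
    fix p assume "p \<in> carrier (semidirect A B \<phi>)"
    then obtain a b where p: "p = (a, b)" "a \<in> carrier A" "b \<in> carrier B"
      by (auto simp: semidirect_def)
    have "\<phi> (inv\<^bsub>B\<^esub> b) (inv\<^bsub>A\<^esub> a) \<otimes>\<^bsub>A\<^esub> \<phi> (inv\<^bsub>B\<^esub> b) a = \<one>\<^bsub>A\<^esub>"
      using p hm[of "inv\<^bsub>B\<^esub> b" "inv\<^bsub>A\<^esub> a" a] hm[of "inv\<^bsub>B\<^esub> b" "\<one>\<^bsub>A\<^esub>" "\<one>\<^bsub>A\<^esub>"]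
        cl[of "inv\<^bsub>B\<^esub> b" "\<one>\<^bsub>A\<^esub>"] by (simp del: \<phi>.hom_inv)
    then show "\<exists>q\<in>carrier (semidirect A B \<phi>).
        q \<otimes>\<^bsub>semidirect A B \<phi>\<^esub> p = \<one>\<^bsub>semidirect A B \<phi>\<^esub>"
      using p by (intro bexI[of _ "(\<phi> (inv\<^bsub>B\<^esub> b) (inv\<^bsub>A\<^esub> a), inv\<^bsub>B\<^esub> b)"])
        (auto simp: semidirect_def cl simp del: \<phi>.hom_inv)
  qed (auto simp: semidirect_def cl hm mlt one A.m_assoc B.m_assoc simp del: \<phi>.hom_mult \<phi>.hom_one)
qed

lemma group_holomorph:
  assumes "group N" shows "group (holomorph N)"
  unfolding holomorph_def using assms
  by (intro group_semidirect group.AutoGroup) (auto simp: hom_def)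

lemma group_action_holomorph:
  assumes "group N"
  shows "group_action (holomorph N) (carrier N) (hol_action N)"
proof -
  interpret N: group N by fact
  have bij: "hol_action N p \<in> Bij (carrier N)" if "p \<in> carrier (holomorph N)" for p
  proof -
    obtain x \<alpha> where p: "p = (x, \<alpha>)" "x \<in> carrier N" "\<alpha> \<in> auto N"
      using \<open>p \<in> _\<close> by (auto simp: holomorph_def semidirect_def AutoGroup_def)
    have \<alpha>: "bij_betw \<alpha> (carrier N) (carrier N)"
      using p by (simp add: auto_def Bij_def)
    have "bij_betw (\<lambda>y. x \<otimes>\<^bsub>N\<^esub> y) (carrier N) (carrier N)"
      using p by (intro bij_betwI[where g = "\<lambda>y. inv\<^bsub>N\<^esub> x \<otimes>\<^bsub>N\<^esub> y"])
        (auto simp flip: N.m_assoc)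
    from bij_betw_trans[OF \<alpha> this] have "bij_betw (hol_action N p) (carrier N) (carrier N)"
      by (rule bij_betw_cong[THEN iffD1, rotated]) (simp add: hol_action_def p)
    then show ?thesis by (simp add: Bij_def hol_action_def p)
  qed
  have "hol_action N (p \<otimes>\<^bsub>holomorph N\<^esub> q)
      = hol_action N p \<otimes>\<^bsub>BijGroup (carrier N)\<^esub> hol_action N q"
    if pq: "p \<in> carrier (holomorph N)" "q \<in> carrier (holomorph N)" for p q
  proof -
    obtain x \<alpha> y \<beta> where p: "p = (x, \<alpha>)" "x \<in> carrier N" "\<alpha> \<in> auto N"
      and q: "q = (y, \<beta>)" "y \<in> carrier N" "\<beta> \<in> auto N"
      using pq by (auto simp: holomorph_def semidirect_def AutoGroup_def)
    have c: "\<alpha> z \<in> carrier N" "\<beta> z \<in> carrier N" if "z \<in> carrier N" for z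
      using p q that by (auto simp: auto_def hom_def)
    have h: "\<alpha> (y \<otimes>\<^bsub>N\<^esub> z) = \<alpha> y \<otimes>\<^bsub>N\<^esub> \<alpha> z" if "z \<in> carrier N" for z
      using p q that by (auto simp: auto_def hom_def)
    have b: "\<alpha> \<in> Bij (carrier N)" "\<beta> \<in> Bij (carrier N)"
      using p q by (auto simp: auto_def)
    show ?thesis
      using bij[OF pq(1)] bij[OF pq(2)] p(2) q(2) c h b
      by (auto simp: p(1) q(1) BijGroup_def AutoGroup_def holomorph_def semidirect_def
          hol_action_def compose_def N.m_assoc fun_eq_iff restrict_def)
  qed
  then show ?thesis
    using bij by (auto simp: group_action_def group_hom_def group_hom_axioms_def hom_def
        group_BijGroup group_holomorph[OF assms]) (auto simp: BijGroup_def)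
qed

end

theory Submission
  imports Defs "HOL-Number_Theory.Residues"
begin

text \<open>
  A group of order \<open>2 n\<close> with \<open>n\<close> odd is a semidirect product of \<open>\<int>\<^sub>n\<close> by \<open>\<int>\<^sub>2\<close> if and only if it
  contains an element of order \<open>n\<close> (\<open>semidirect_iff_element_of_order\<close>). Let \<open>H\<close> be the regular
  subgroup of the holomorph of \<open>N\<close> that is isomorphic to \<open>G\<close>. It remains to compare the elements of
  order \<open>n\<close> in \<open>H\<close> and in \<open>N\<close>. The solutions of \<open>x\<^sup>n = 1\<close> form a characteristic subgroup \<open>N1\<close> of order
  \<open>n\<close> in \<open>N\<close> (\<open>odd_part_of_twice_odd\<close>), and the elements of \<open>H\<close> with translation part in \<open>N1\<close> form a
  subgroup \<open>H1\<close> of order \<open>n\<close> that acts transitively on \<open>N1\<close>. So the claim is that \<open>H1\<close> is cyclic if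
  and only if \<open>N1\<close> is. The Burnside condition enters in the form that \<open>n\<close> is coprime to \<open>p - 1\<close> for
  every prime \<open>p\<close> dividing \<open>n\<close>: automorphisms whose order divides a power of \<open>n\<close> act trivially on
  groups of order \<open>p\<close>.

  Suppose that \<open>N1\<close> is generated by \<open>m\<close>. The element \<open>h\<close> of \<open>H1\<close> that sends the identity to \<open>m\<close> is a map
  \<open>x \<mapsto> m \<beta>(x)\<close> with \<open>\<beta>(m) = m\<^sup>u\<close>, and \<open>u \<equiv> 1\<close> modulo each prime divisor of \<open>n\<close>. Its \<open>k\<close>-th power sends
  the identity to the power of \<open>m\<close> with exponent \<open>1 + u + \<dots> + u\<^sup>k\<^sup>-\<^sup>1\<close>. As \<open>n\<close> is odd, that number
  is divisible by \<open>n\<close> only if \<open>k\<close> is (\<open>dvd_geoD\<close>), so \<open>h\<close> generates \<open>H1\<close>.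

  Suppose that \<open>H1\<close> is generated by \<open>x \<mapsto> c \<alpha>(x)\<close>. Then this map permutes \<open>N1\<close> in a single cycle, and
  it has to be shown that a group with such an affine cycle is cyclic (\<open>affine_cycle_imp_cyclic\<close>). The
  proof is by induction on the order, as affine cycles pass to \<open>\<alpha>\<close>-invariant subgroups and quotients.
  The start is an argument of Ito: the group generated by the translations and \<open>\<alpha>\<close> is the product of
  two cyclic groups, and hence the commutators of translations with powers of \<open>\<alpha>\<close> commute with each
  other (\<open>\<delta>_commute\<close>). If \<open>\<alpha>\<close> is the identity, then \<open>c\<close> generates the group; otherwise these
  commutators lead to a proper nontrivial invariant normal subgroup (\<open>proper_invariant_normal_subgroup\<close>). By induction that subgroup is cyclic, so it
  contains an invariant subgroup of prime order. The latter is central by the Burnside condition, and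
  the quotient by it is cyclic by induction, so the group is abelian. In the abelian case, too many
  elements of order \<open>p\<close> would make the cycle too short (\<open>cyclic_if_abelian\<close>).
\<close>

section \<open>Geometric sums and divisibility\<close>

definition geo :: "nat \<Rightarrow> nat \<Rightarrow> nat" where
  "geo u k = (\<Sum>i<k. u ^ i)"

lemma geo_add: "geo u (a + b) = geo u a + u ^ a * geo u b"
  by (induction b) (auto simp: geo_def power_add algebra_simps)

lemma geo_mult: "geo u (m * k) = geo u m * geo (u ^ m) k"
proof (induction k)
  case (Suc k)
  have "geo u (m * Suc k) = geo u (m * k) + u ^ (m * k) * geo u m"
    by (simp add: geo_add add.commute[of m])
  then have "geo u (m * Suc k) = geo u m * geo (u ^ m) k + (u ^ m) ^ k * geo u m"
    by (simp only: Suc.IH power_mult)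
  moreover have "geo (u ^ m) (Suc k) = geo (u ^ m) k + (u ^ m) ^ k"
    by (simp add: geo_def)
  ultimately show ?case by (simp add: distrib_left mult.commute)
qed (simp add: geo_def)

lemma geo_cong:
  assumes "[u = 1] (mod q)"
  shows "[geo u k = k] (mod q)"
proof -
  have "[geo u k = (\<Sum>i<k. 1)] (mod q)"
    unfolding geo_def
    by (intro cong_sum) (use cong_pow[OF assms] in auto)
  then show ?thesis by simp
qed

text \<open>Writing \<open>u = 1 + p t\<close>, the terms of the sum are \<open>1 + i p t\<close> modulo \<open>p\<^sup>2\<close>, and for odd \<open>p\<close>
  the sum of the \<open>i < p\<close> is itself a multiple of \<open>p\<close>. The congruence fails for \<open>p = 2\<close>,
  \<open>u = 3\<close>.\<close>

lemma geo_prime_cong: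
  assumes "odd p" "[u = 1] (mod p)"
  shows "[geo u p = p] (mod p ^ 2)"
proof -
  obtain t where t: "int u = 1 + int p * t"
  proof -
    have "[int u = int 1] (mod int p)" using assms(2) by (simp only: cong_int_iff)
    then obtain t where "int u - 1 = int p * t" unfolding cong_iff_dvd_diff by auto
    then show ?thesis by (intro that[of t]) simp
  qed
  have pw: "[int u ^ i = 1 + int i * (int p * t)] (mod (int p) ^ 2)" for i
  proof (induction i)
    case (Suc i)
    have "[int u * int u ^ i = (1 + int p * t) * (1 + int i * (int p * t))] (mod (int p)^2)"
      unfolding t[symmetric] by (rule cong_mult[OF cong_refl Suc])
    moreover have "(1 + int p * t) * (1 + int i * (int p * t)) =
      (1 + int (Suc i) * (int p * t)) + (int p)^2 * (int i * t * t)"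
      by (simp add: algebra_simps power2_eq_square)
    ultimately show ?case
      by (simp add: cong_def)
  qed auto
  have "[(\<Sum>i<p. int u ^ i) = (\<Sum>i<p. 1 + int i * (int p * t))] (mod (int p)^2)"
    by (intro cong_sum pw)
  also have "(\<Sum>i<p. 1 + int i * (int p * t)) = int p + (\<Sum>i<p. int i) * (int p * t)"
    by (simp add: sum.distrib sum_distrib_right)
  also have "(\<Sum>i<p. int i) = int p * ((int p - 1) div 2)"
  proof -
    have "2 * (\<Sum>i<k. int i) = int k * (int k - 1)" for k
      by (induction k) (auto simp: algebra_simps)
    moreover have "2 * ((int p - 1) div 2) = int p - 1" using assms(1) by simp
    ultimately have "2 * (\<Sum>i<p. int i) = 2 * (int p * ((int p - 1) div 2))"
      by (simp add: mult.left_commute)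
    then show ?thesis by simp
  qed
  also have "[int p + int p * ((int p - 1) div 2) * (int p * t) = int p] (mod (int p)^2)"
    by (simp add: cong_iff_dvd_diff power2_eq_square)
  finally have "[int (geo u p) = int p] (mod int (p ^ 2))"
    by (simp add: geo_def)
  then show ?thesis by (simp only: cong_int_iff)
qed

text \<open>The exponent sums \<open>geo u k\<close> behave like \<open>k\<close> when \<open>u\<close> is 1 modulo every prime divisor of \<open>n\<close>.
  One prime \<open>p\<close> is split off from \<open>n\<close> at a time: \<open>geo u (p k') = geo u p * geo (u\<^sup>p) k'\<close>, and
  \<open>geo u p\<close> is \<open>p\<close> times a number coprime to \<open>n / p\<close>, by the congruence modulo \<open>p\<^sup>2\<close> at the prime
  \<open>p\<close> and by \<open>geo u p \<equiv> p\<close> at the others.\<close>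

lemma dvd_geoD:
  assumes "odd n" "\<And>p. Factorial_Ring.prime p \<Longrightarrow> p dvd n \<Longrightarrow> [u = 1] (mod p)" "n dvd geo u k"
  shows "n dvd k"
  using assms
proof (induction n arbitrary: u k rule: less_induct)
  case (less n)
  show ?case
  proof (cases "n = 1")
    case False
    then obtain p where p: "Factorial_Ring.prime p" "p dvd n" by (metis prime_factor_nat)
    then obtain n' where n: "n = p * n'" by blast
    have odd: "odd p" "odd n'" using less.prems(1) unfolding n by simp_all
    have p1: "p > 1" by (rule prime_gt_1_nat[OF p(1)])
    then have n': "n' < n" "n' > 0" using n odd p1 by (auto intro!: gr0I)
    have "p dvd geo u k" using p less.prems(3) by (meson dvd_trans)
    then have "p dvd k"
      using geo_cong[OF less.prems(2)[OF p]] cong_dvd_iff by blast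
    then obtain k' where k: "k = p * k'" by blast
    obtain w where w: "geo u p = p * w"
      using cong_dvd_iff[OF geo_cong[OF less.prems(2)[OF p], of p]] by auto
    have "coprime n' w"
    proof (rule ccontr)
      assume "\<not> coprime n' w"
      then obtain q where q: "Factorial_Ring.prime q" "q dvd n'" "q dvd w"
        using prime_factor_nat[of "gcd n' w"] by (auto simp: coprime_iff_gcd_eq_1)
      have "q dvd n" using q n by simp
      show False
      proof (cases "q = p")
        case True
        have "p * p dvd geo u p" using q True w by simp
        then have "p * p dvd p"
          using geo_prime_cong[OF odd(1) less.prems(2)[OF p]]
          by (simp add: cong_dvd_iff power2_eq_square)
        then show False using p1 by (auto dest: dvd_imp_le)
      next
        case False
        have "q dvd p"
          using geo_cong[OF less.prems(2)[OF q(1) \<open>q dvd n\<close>], of p] q w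
          by (auto dest: cong_dvd_iff)
        then show False using False primes_dvd_imp_eq[OF q(1) p(1)] by blast
      qed
    qed
    moreover have "n' dvd w * geo (u ^ p) k'"
      using less.prems(3) p1 unfolding k n geo_mult w by (simp add: mult.assoc)
    ultimately have "n' dvd geo (u ^ p) k'"
      using coprime_dvd_mult_right_iff by blast
    moreover have "[u ^ p = 1] (mod q)" if "Factorial_Ring.prime q" "q dvd n'" for q
      using cong_pow[OF less.prems(2)[OF that(1)], of p] that n by auto
    ultimately have "n' dvd k'"
      using less.IH[OF n'(1) odd(2)] by blast
    then show ?thesis by (simp add: n k)
  qed simp
qed

text \<open>The order of \<open>v\<close> modulo \<open>p\<close> divides both \<open>n\<close> and \<open>p - 1\<close>.\<close>

lemma pow_cong_1_coprime:
  fixes p v n :: nat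
  assumes "Factorial_Ring.prime p" "[v ^ n = 1] (mod p)" "coprime n (p - 1)" "n > 0"
  shows "[v = 1] (mod p)"
proof -
  obtain a b where ab: "n * a = (p - 1) * b + 1"
    using bezout_nat[of n "p - 1"] assms(3,4) by auto
  have "\<not> p dvd v"
  proof
    assume "p dvd v"
    then have "p dvd v ^ n" using assms(4) by (simp add: dvd_power_iff_le dvd_trans)
    then have "p dvd 1" using assms(2) cong_dvd_iff by blast
    then show False using assms(1) by auto
  qed
  then have "[v ^ (p - 1) = 1] (mod p)" using assms(1) fermat_theorem by blast
  then have "[v ^ ((p - 1) * b) * v = 1 * v] (mod p)"
    using cong_scalar_right[OF cong_pow[of "v ^ (p - 1)" 1 p b], of v] by (simp add: power_mult)
  moreover have "[v ^ (n * a) = 1] (mod p)"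
    using cong_pow[OF assms(2), of a] by (simp add: power_mult)
  ultimately have "[1 = 1 * v] (mod p)"
    unfolding ab power_add power_one_right by (blast intro: cong_trans cong_sym)
  then show ?thesis by (simp add: cong_sym_eq)
qed

section \<open>Affine maps that are a single cycle\<close>

text \<open>Centralisers are subgroups: an element that commutes with the generators commutes with the
  group that they generate. This is applied to the generators first and then to its result.\<close>

lemma (in group) generate_commute:
  assumes S: "S \<subseteq> carrier G" and comm: "\<And>x y. x \<in> S \<Longrightarrow> y \<in> S \<Longrightarrow> x \<otimes> y = y \<otimes> x"
    and "x \<in> generate G S" "y \<in> generate G S"
  shows "x \<otimes> y = y \<otimes> x"
proof -
  have inv_commute: "a \<otimes> inv b = inv b \<otimes> a"
    if "a \<in> carrier G" "b \<in> carrier G" "a \<otimes> b = b \<otimes> a" for a b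
  proof -
    have "a \<otimes> inv b = inv b \<otimes> (b \<otimes> a) \<otimes> inv b"
      using that by (simp add: m_assoc[symmetric])
    also have "\<dots> = inv b \<otimes> (a \<otimes> b) \<otimes> inv b" using that by simp
    also have "\<dots> = inv b \<otimes> a" using that(1,2) by (simp add: m_assoc)
    finally show ?thesis .
  qed
  note gen = generate_in_carrier[OF S]
  have S': "s \<in> carrier G" if "s \<in> S" for s using S that by blast
  have centralises: "a \<otimes> z = z \<otimes> a"
    if a: "a \<in> carrier G" "\<And>s. s \<in> S \<Longrightarrow> a \<otimes> s = s \<otimes> a" and "z \<in> generate G S" for a z
    using that(3)
  proof (induction z)
    case (eng h k)
    have "a \<otimes> (h \<otimes> k) = (a \<otimes> h) \<otimes> k" using a gen eng.hyps by (simp add: m_assoc)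
    also have "\<dots> = h \<otimes> (a \<otimes> k)" using a gen eng by (simp add: m_assoc)
    also have "\<dots> = (h \<otimes> k) \<otimes> a" using a gen eng by (simp add: m_assoc)
    finally show ?case .
  qed (use a S' inv_commute in auto)
  have "s \<otimes> x = x \<otimes> s" if "s \<in> S" for s
    using centralises[OF S'[OF that] _ assms(3)] comm that by blast
  then show ?thesis
    using centralises[of x y] gen assms(3,4) by metis
qed

text \<open>The affine map \<open>x \<mapsto> c \<otimes> \<alpha> x\<close>, called \<open>g\<close> in the comments below, permutes the finite group
  \<open>N\<close> in one single cycle. A cyclic regular subgroup of the holomorph is the same thing as such a
  cycle, but the present form passes directly to invariant subgroups and to quotients.\<close>

locale affine_cycle = group N for N (structure) +
  fixes \<alpha> :: "'a \<Rightarrow> 'a" and c :: 'a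
  assumes fin: "finite (carrier N)"
    and \<alpha>_hom: "\<alpha> \<in> hom N N" and \<alpha>_inj: "inj_on \<alpha> (carrier N)"
    and c_closed [simp]: "c \<in> carrier N"
    and trans: "x \<in> carrier N \<Longrightarrow> \<exists>k. ((\<lambda>y. c \<otimes> \<alpha> y) ^^ k) \<one> = x"
begin

definition s :: "nat \<Rightarrow> 'a" where
  "s k = ((\<lambda>y. c \<otimes> \<alpha> y) ^^ k) \<one>"

lemma s_0 [simp]: "s 0 = \<one>" and s_Suc: "s (Suc k) = c \<otimes> \<alpha> (s k)"
  by (simp_all add: s_def)

lemma s_surj: "x \<in> carrier N \<Longrightarrow> \<exists>k. x = s k"
  using trans by (auto simp: s_def)

lemma order_pos: "order N > 0"
  using fin order_gt_0_iff_finite by blast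

lemma \<alpha>_pow_hom: "(\<alpha> ^^ k) \<in> hom N N"
proof (induction k)
  case (Suc k)
  then show ?case using \<alpha>_hom by (auto simp: hom_def Pi_iff)
qed (auto simp: hom_def)

lemma \<alpha>_pow_closed [simp]: "x \<in> carrier N \<Longrightarrow> (\<alpha> ^^ k) x \<in> carrier N"
  and \<alpha>_pow_mult: "x \<in> carrier N \<Longrightarrow> y \<in> carrier N \<Longrightarrow>
    (\<alpha> ^^ k) (x \<otimes> y) = (\<alpha> ^^ k) x \<otimes> (\<alpha> ^^ k) y"
  using \<alpha>_pow_hom[of k] by (auto simp: hom_def)

lemma \<alpha>_closed [simp]: "x \<in> carrier N \<Longrightarrow> \<alpha> x \<in> carrier N"
  and \<alpha>_mult: "x \<in> carrier N \<Longrightarrow> y \<in> carrier N \<Longrightarrow> \<alpha> (x \<otimes> y) = \<alpha> x \<otimes> \<alpha> y"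
  using \<alpha>_hom by (auto simp: hom_def)

lemma \<alpha>_pow_one [simp]: "(\<alpha> ^^ k) \<one> = \<one>"
  using hom_one[OF \<alpha>_pow_hom is_group is_group] .

lemma \<alpha>_pow_inv: "x \<in> carrier N \<Longrightarrow> (\<alpha> ^^ k) (inv x) = inv ((\<alpha> ^^ k) x)"
  using group_hom.hom_inv[of N N "\<alpha> ^^ k" x] \<alpha>_pow_hom
  by (simp add: group_hom_def group_hom_axioms_def)

lemma \<alpha>_pow_inj: "inj_on (\<alpha> ^^ k) (carrier N)"
proof (induction k)
  case (Suc k)
  have "(\<alpha> ^^ k) ` carrier N \<subseteq> carrier N" by auto
  then have "inj_on (\<alpha> \<circ> (\<alpha> ^^ k)) (carrier N)"
    using Suc \<alpha>_inj by (blast intro: comp_inj_on inj_on_subset)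
  then show ?case by (simp add: comp_def)
qed simp

lemma \<alpha>_pow_add: "(\<alpha> ^^ k) ((\<alpha> ^^ l) x) = (\<alpha> ^^ (k + l)) x"
  by (simp add: funpow_add)

lemma s_closed [simp]: "s k \<in> carrier N"
  by (induction k) (simp_all add: s_Suc)

text \<open>Since \<open>g\<^sup>j\<close> is \<open>x \<mapsto> s j \<otimes> \<alpha>\<^sup>j x\<close>, the rule \<open>(s j, s k) \<mapsto> s (j + k)\<close> is a second group structure on
  \<open>N\<close>, and that structure is commutative. In the proofs below this commutativity is used in the form
  \<open>x \<otimes> \<alpha>\<^sup>i y = y \<otimes> \<alpha>\<^sup>j x\<close> for \<open>x = s i\<close> and \<open>y = s j\<close>.\<close>

lemma s_add: "s (j + k) = s j \<otimes> (\<alpha> ^^ j) (s k)"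
proof (induction j)
  case (Suc j)
  then have "s (Suc j + k) = c \<otimes> \<alpha> (s j \<otimes> (\<alpha> ^^ j) (s k))" by (simp only: s_Suc add_Suc)
  then show ?case by (simp add: s_Suc \<alpha>_mult m_assoc)
qed simp

lemma order_le_period:
  assumes "s k = \<one>" "k > 0" shows "order N \<le> k"
proof -
  have "s (r + k * q) = s r" for r q
  proof (induction q)
    case (Suc q)
    have "s (r + k * Suc q) = s ((r + k * q) + k)" by (simp add: algebra_simps)
    also have "\<dots> = s r" unfolding s_add[of "r + k * q"] using Suc assms by simp
    finally show ?case .
  qed simp
  then have "s m = s (m mod k)" for m
    using mod_mult_div_eq[of m k] by metis
  then have "s m \<in> s ` {..<k}" for m
    using assms(2) by (intro image_eqI[of _ _ "m mod k"]) auto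
  then have "carrier N \<subseteq> s ` {..<k}"
    using s_surj by blast
  then show ?thesis
    unfolding order_def using surj_card_le[of "{..<k}"] by simp
qed

lemma s_order: "s (order N) = \<one>"
proof -
  have "\<not> inj_on s {..order N}"
    using card_inj_on_le[of s "{..order N}" "carrier N"] fin by (auto simp: order_def image_subset_iff)
  \<comment> \<open>Pigeonhole: two equal values make the orbit return to the identity after their distance.\<close>
  then obtain i j where ij: "i < j" "j \<le> order N" "s i = s j"
    by (metis (no_types, lifting) atMost_iff inj_onI linorder_neqE_nat)
  have "s j = s i \<otimes> (\<alpha> ^^ i) (s (j - i))" using s_add[of i "j - i"] ij by simp
  then have "(\<alpha> ^^ i) (s (j - i)) = (\<alpha> ^^ i) \<one>" using ij by simp
  then have 1: "s (j - i) = \<one>" using \<alpha>_pow_inj by (metis inj_onD one_closed s_closed)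
  then have "j - i = order N" using order_le_period[OF 1] ij by simp
  then show ?thesis using 1 by simp
qed

lemma \<alpha>_pow_order: "x \<in> carrier N \<Longrightarrow> (\<alpha> ^^ (order N * q)) x = x"
proof (induction q)
  case (Suc q)
  from s_surj[OF Suc.prems] obtain k where k: "x = s k" ..
  have "(\<alpha> ^^ order N) (s k) = s (order N + k)" using s_add[of "order N" k] s_order by simp
  also have "\<dots> = s (k + order N)" by (simp only: add.commute)
  also have "\<dots> = s k" using s_add[of k "order N"] s_order by simp
  finally have "(\<alpha> ^^ order N) x = x" using k by simp
  moreover have "(\<alpha> ^^ (order N * Suc q)) x = (\<alpha> ^^ order N) ((\<alpha> ^^ (order N * q)) x)"
    unfolding mult_Suc_right funpow_add by simp
  ultimately show ?case using Suc by simp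
qed simp

lemma \<alpha>_pow_inverse: "\<exists>b. \<forall>x\<in>carrier N. (\<alpha> ^^ a) ((\<alpha> ^^ b) x) = x"
proof -
  have "a + (order N - 1) * a = order N * a"
    using order_pos by (cases "order N") auto
  then show ?thesis
    using \<alpha>_pow_order by (intro exI[of _ "(order N - 1) * a"]) (simp add: \<alpha>_pow_add)
qed

text \<open>In the holomorph, \<open>\<delta> k x\<close> is the commutator of \<open>\<alpha>\<^sup>k\<close> with the translation by \<open>x\<close>, and also the
  commutator of \<open>\<alpha>\<^sup>k\<close> with the power of \<open>g\<close> that sends the identity to \<open>x\<close>.\<close>

definition \<delta> :: "nat \<Rightarrow> 'a \<Rightarrow> 'a" where
  "\<delta> k x = (\<alpha> ^^ k) x \<otimes> inv x"

lemma \<delta>_closed [simp]: "x \<in> carrier N \<Longrightarrow> \<delta> k x \<in> carrier N"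
  by (simp add: \<delta>_def)

lemma \<alpha>_\<delta>: "x \<in> carrier N \<Longrightarrow> (\<alpha> ^^ l) (\<delta> k x) = \<delta> k ((\<alpha> ^^ l) x)"
  by (simp add: \<delta>_def \<alpha>_pow_mult \<alpha>_pow_inv \<alpha>_pow_add add.commute)

text \<open>The permutations of the form \<open>z \<mapsto> x \<otimes> \<alpha>\<^sup>k z\<close> form a group that is the product of its abelian
  subgroups \<open>\<langle>\<alpha>\<rangle>\<close> and \<open>\<langle>g\<rangle>\<close>. Therefore \<open>g\<^sup>i \<alpha>\<^sup>a g\<^sup>-\<^sup>i\<close> can be written as \<open>\<alpha>\<^sup>a\<^sup>+\<^sup>l g\<^sup>-\<^sup>l\<close>, and
  conjugation by \<open>g\<^sup>i\<close> takes the commutator of \<open>\<alpha>\<^sup>a\<close> and a power of \<open>g\<close> to the commutator of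
  \<open>\<alpha>\<^sup>a\<^sup>+\<^sup>l\<close> and the same power of \<open>g\<close>. What matters later is that \<open>l\<close> does not depend on \<open>y\<close>.\<close>

lemma conj_\<delta>:
  "\<exists>l. \<forall>y\<in>carrier N. s i \<otimes> (\<alpha> ^^ i) (\<delta> a y) \<otimes> inv (s i) = \<delta> (a + l) y"
proof -
  obtain b where b: "\<And>x. x \<in> carrier N \<Longrightarrow> (\<alpha> ^^ a) ((\<alpha> ^^ b) x) = x"
    using \<alpha>_pow_inverse by blast
  define w where "w = s i"
  \<comment> \<open>Evaluated at the identity, the factorisation of the conjugate determines \<open>v = s l\<close>.\<close>
  define v where "v = w \<otimes> inv ((\<alpha> ^^ b) w)"
  have w [simp]: "w \<in> carrier N" and v [simp]: "v \<in> carrier N" by (simp_all add: w_def v_def)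
  obtain l where l: "v = s l" using s_surj v by blast
  have Av: "(\<alpha> ^^ a) v = (\<alpha> ^^ a) w \<otimes> inv w"
    by (simp add: v_def \<alpha>_pow_mult \<alpha>_pow_inv b)
  have "w \<otimes> (\<alpha> ^^ i) (\<delta> a y) \<otimes> inv w = \<delta> (a + l) y" if y [simp]: "y \<in> carrier N" for y
  proof -
    obtain j where j: "y = s j" using s_surj y by blast
    define q where "q = w \<otimes> (\<alpha> ^^ i) y"
    have q [simp]: "q \<in> carrier N" by (simp add: q_def)
    have q': "q = y \<otimes> (\<alpha> ^^ j) w"
      unfolding q_def j w_def by (metis s_add add.commute)
    have vy: "v \<otimes> (\<alpha> ^^ l) y = y \<otimes> (\<alpha> ^^ j) v"
      unfolding j l by (metis s_add add.commute)
    have "w \<otimes> (\<alpha> ^^ i) (\<delta> a y) \<otimes> inv w = w \<otimes> (\<alpha> ^^ a) ((\<alpha> ^^ i) y) \<otimes> inv q"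
      unfolding \<alpha>_\<delta>[OF y] by (simp add: \<delta>_def q_def inv_mult_group m_assoc)
    also have "\<dots> = inv ((\<alpha> ^^ a) v) \<otimes> (\<alpha> ^^ a) q \<otimes> inv q"
      unfolding Av by (simp add: q_def \<alpha>_pow_mult inv_mult_group m_assoc inv_solve_left)
    finally have L: "w \<otimes> (\<alpha> ^^ i) (\<delta> a y) \<otimes> inv w = inv ((\<alpha> ^^ a) v) \<otimes> (\<alpha> ^^ a) q \<otimes> inv q" .
    have "(\<alpha> ^^ l) y = inv v \<otimes> (y \<otimes> (\<alpha> ^^ j) v)"
      using vy by (simp add: inv_solve_left)
    then have "(\<alpha> ^^ (a + l)) y = inv ((\<alpha> ^^ a) v) \<otimes> ((\<alpha> ^^ a) y \<otimes> (\<alpha> ^^ j) ((\<alpha> ^^ a) v))"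
      by (simp add: \<alpha>_pow_mult \<alpha>_pow_inv flip: \<alpha>_pow_add) (simp add: \<alpha>_pow_add add.commute)
    also have "(\<alpha> ^^ a) y \<otimes> (\<alpha> ^^ j) ((\<alpha> ^^ a) v) = (\<alpha> ^^ a) q \<otimes> inv ((\<alpha> ^^ j) w)"
      unfolding Av q' by (simp add: \<alpha>_pow_mult \<alpha>_pow_inv m_assoc) (simp add: \<alpha>_pow_add add.commute)
    finally have "\<delta> (a + l) y = inv ((\<alpha> ^^ a) v) \<otimes> (\<alpha> ^^ a) q \<otimes> inv q"
      by (simp add: \<delta>_def q' inv_mult_group m_assoc)
    with L show ?thesis by simp
  qed
  then show ?thesis unfolding w_def by blast
qed

text \<open>This is Ito's argument that a product of two abelian groups is metabelian. Because \<open>l\<close> in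
  \<open>conj_\<delta>\<close> is independent of \<open>y\<close>, conjugation by \<open>g\<^sup>i\<close> and \<open>\<alpha>\<^sup>k\<close> can be applied to \<open>\<delta> a z\<close> in either
  order with the same result. If \<open>s i\<close> is the inverse of \<open>x\<close>, the two orders differ by
  conjugation with the inverse of \<open>\<delta> k x\<close>.\<close>

lemma \<delta>_commute:
  assumes x: "x \<in> carrier N" and y: "y \<in> carrier N"
  shows "\<delta> k x \<otimes> \<delta> a y = \<delta> a y \<otimes> \<delta> k x"
proof -
  obtain i where i: "inv x = s i" using s_surj x by (metis inv_closed)
  obtain l where l: "\<And>z. z \<in> carrier N \<Longrightarrow>
      s i \<otimes> (\<alpha> ^^ i) (\<delta> a z) \<otimes> inv (s i) = \<delta> (a + l) z"
    using conj_\<delta> by blast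
  obtain z where z: "z \<in> carrier N" "(\<alpha> ^^ (i + k)) z = y"
    using \<alpha>_pow_inverse[of "i + k"] y by (metis \<alpha>_pow_closed)
  define d where "d = \<delta> a y"
  define e where "e = x \<otimes> inv ((\<alpha> ^^ k) x)"
  have [simp]: "d \<in> carrier N" "e \<in> carrier N" using x y by (simp_all add: d_def e_def)
  have d: "(\<alpha> ^^ k) ((\<alpha> ^^ i) (\<delta> a z)) = d" "(\<alpha> ^^ i) (\<delta> a ((\<alpha> ^^ k) z)) = d"
    using z by (simp_all add: \<alpha>_\<delta> d_def \<alpha>_pow_add add.commute)
  have "(\<alpha> ^^ k) (s i \<otimes> (\<alpha> ^^ i) (\<delta> a z) \<otimes> inv (s i)) = (\<alpha> ^^ k) (\<delta> (a + l) z)"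
    using l z by simp
  also have "\<dots> = \<delta> (a + l) ((\<alpha> ^^ k) z)" using z by (simp add: \<alpha>_\<delta>)
  also have "\<dots> = s i \<otimes> d \<otimes> inv (s i)"
    using l[of "(\<alpha> ^^ k) z"] z d by simp
  finally have "inv ((\<alpha> ^^ k) x) \<otimes> d \<otimes> (\<alpha> ^^ k) x = inv x \<otimes> d \<otimes> x"
    using x z d unfolding i[symmetric] by (simp add: \<alpha>_pow_mult \<alpha>_pow_inv)
  then have "x \<otimes> (inv ((\<alpha> ^^ k) x) \<otimes> d \<otimes> (\<alpha> ^^ k) x) \<otimes> inv ((\<alpha> ^^ k) x)
      = x \<otimes> (inv x \<otimes> d \<otimes> x) \<otimes> inv ((\<alpha> ^^ k) x)" by simp
  then have ed: "e \<otimes> d = d \<otimes> e"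
    using x by (simp add: e_def m_assoc) (simp add: m_assoc[symmetric])
  have "\<delta> k x = inv e" using x by (simp add: \<delta>_def e_def inv_mult_group)
  moreover have "inv e \<otimes> d = d \<otimes> inv e"
    using ed by (metis \<open>d \<in> carrier N\<close> \<open>e \<in> carrier N\<close> inv_closed inv_solve_left inv_solve_right m_assoc m_closed)
  ultimately show ?thesis by (simp add: d_def)
qed

text \<open>The commutator subgroup of \<open>N\<close> and \<open>\<langle>\<alpha>\<rangle>\<close>: the smallest normal \<open>\<alpha>\<close>-invariant subgroup modulo
  which \<open>\<alpha>\<close> acts trivially. It is abelian because its generators commute.\<close>

definition D :: "'a set" where
  "D = generate N (\<Union>k. \<delta> k ` carrier N)"

lemma D_gens: "(\<Union>k. \<delta> k ` carrier N) \<subseteq> carrier N"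
  by auto

lemma D_subgroup: "subgroup D N"
  unfolding D_def by (rule generate_is_subgroup[OF D_gens])

lemma D_comm: "x \<in> D \<Longrightarrow> y \<in> D \<Longrightarrow> x \<otimes> y = y \<otimes> x"
  unfolding D_def by (rule generate_commute[OF D_gens]) (auto intro: \<delta>_commute)

lemma \<delta>_in_D: "x \<in> carrier N \<Longrightarrow> \<delta> k x \<in> D"
  unfolding D_def by (rule generate.incl) blast

lemma D_normal: "D \<lhd> N"
proof (rule normal_invI[OF D_subgroup])
  interpret D: subgroup D N by (rule D_subgroup)
  fix x h assume x: "x \<in> carrier N" and h: "h \<in> D"
  have conj: "x \<otimes> \<delta> k y \<otimes> inv x \<in> D" if "y \<in> carrier N" for k y
  proof -
    have "x \<otimes> \<delta> k y \<otimes> inv x = inv (\<delta> k x) \<otimes> \<delta> k (x \<otimes> y)"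
      using x that by (simp add: \<delta>_def \<alpha>_pow_mult inv_mult_group m_assoc inv_solve_left)
    then show ?thesis
      using x that by (simp add: \<delta>_in_D)
  qed
  show "x \<otimes> h \<otimes> inv x \<in> D"
    using h[unfolded D_def]
  proof (induction rule: generate.induct)
    case one
    then show ?case using x by simp
  next
    case (incl h)
    then show ?case using conj by auto
  next
    case (inv h)
    then obtain k y where "h = \<delta> k y" "y \<in> carrier N" by blast
    then have "x \<otimes> inv h \<otimes> inv x = inv (x \<otimes> \<delta> k y \<otimes> inv x)"
      using x by (simp add: inv_mult_group m_assoc)
    then show ?case using conj \<open>y \<in> carrier N\<close> by simp
  next
    case (eng h k)
    have "h \<in> carrier N" "k \<in> carrier N" using eng.hyps generate_in_carrier[OF D_gens] by auto
    then have "x \<otimes> (h \<otimes> k) \<otimes> inv x = (x \<otimes> h \<otimes> inv x) \<otimes> (x \<otimes> k \<otimes> inv x)"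
      using x by (simp add: m_assoc inv_solve_left)
    then show ?case using eng by simp
  qed
qed

lemma D_invariant: "\<alpha> ` D \<subseteq> D"
proof clarify
  fix h assume "h \<in> D"
  then show "\<alpha> h \<in> D"
    unfolding D_def
  proof (induction rule: generate.induct)
    case one
    then show ?case using \<alpha>_pow_one[of 1] by (simp add: generate.one)
  next
    case (incl h)
    then show ?case using \<alpha>_\<delta>[of _ 1] by (intro generate.incl) fastforce
  next
    case (inv h)
    then show ?case using \<alpha>_\<delta>[of _ 1] \<alpha>_pow_inv[of _ 1] \<delta>_closed by (fastforce intro: generate.inv)
  next
    case (eng h k)
    then show ?case using \<alpha>_mult generate_in_carrier[OF D_gens] by (auto intro!: generate.eng)
  qed
qed

end

section \<open>Finite cyclic groups and groups of prime order\<close>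

text \<open>Only meaningful for finite groups: an element of infinite order has order 0 here, and so has its
  group.\<close>

definition cyclic :: "('a, 'b) monoid_scheme \<Rightarrow> bool" where
  "cyclic G \<longleftrightarrow> (\<exists>x\<in>carrier G. group.ord G x = order G)"

lemma (in group) powers_of_generator:
  assumes "finite (carrier G)" "x \<in> carrier G" "ord x = order G" "y \<in> carrier G"
  shows "\<exists>k::nat. y = x [^] k"
proof -
  have gen: "generate G {x} = {x [^] k | k. k \<in> (UNIV :: nat set)}"
    by (rule generate_pow_on_finite_carrier[OF assms(1,2)])
  have "card (generate G {x}) = card (carrier G)"
    using generate_pow_card[OF assms(2)] assms(3) by (simp add: order_def)
  then have "generate G {x} = carrier G"
    using assms(2) by (intro card_subset_eq[OF assms(1) generate_incl]) auto
  then have "y \<in> {x [^] k | k. k \<in> (UNIV :: nat set)}" using gen assms(4) by simp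
  then show ?thesis by simp
qed

lemma (in group) cyclicI:
  assumes "finite (carrier G)" "x \<in> carrier G" "\<And>y. y \<in> carrier G \<Longrightarrow> \<exists>k::nat. y = x [^] k"
  shows "cyclic G"
proof -
  have "generate G {x} = {x [^] k | k. k \<in> (UNIV :: nat set)}"
    by (rule generate_pow_on_finite_carrier[OF assms(1,2)])
  also have "\<dots> = carrier G"
    using assms(2,3) by auto
  finally have "ord x = order G"
    using generate_pow_card[OF assms(2)] by (simp add: order_def)
  then show ?thesis using assms(2) by (auto simp: cyclic_def)
qed

lemma (in group) nat_pow_eq_iff_cong:
  fixes m n :: nat
  assumes "x \<in> carrier G"
  shows "x [^] m = x [^] n \<longleftrightarrow> [m = n] (mod ord x)"
proof -
  have "x [^] m = x [^] n \<longleftrightarrow> int (ord x) dvd int n - int m"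
    using int_pow_eq[OF assms, of "int m" "int n"] by (simp add: int_pow_int)
  also have "\<dots> \<longleftrightarrow> [int n = int m] (mod int (ord x))"
    by (simp add: cong_iff_dvd_diff)
  also have "\<dots> \<longleftrightarrow> [m = n] (mod ord x)"
    by (simp only: cong_int_iff cong_sym_eq)
  finally show ?thesis .
qed

lemma (in group) cyclic_subgroupE:
  assumes "finite (carrier G)" "subgroup H G" "cyclic (G\<lparr>carrier := H\<rparr>)"
  obtains x where "x \<in> H" "ord x = card H" "\<And>y. y \<in> H \<Longrightarrow> \<exists>k::nat. y = x [^] k"
proof -
  interpret H: group "G\<lparr>carrier := H\<rparr>" by (rule subgroup_imp_group[OF assms(2)])
  have fin: "finite H" by (rule finite_subset[OF subgroup.subset[OF assms(2)] assms(1)])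
  obtain x where x: "x \<in> H" "H.ord x = card H"
    using assms(3) by (auto simp: cyclic_def order_def)
  have xG: "x \<in> carrier G" by (rule subgroup.mem_carrier[OF assms(2) x(1)])
  have "x [^] k = \<one> \<longleftrightarrow> H.ord x dvd k" for k :: nat
  proof -
    have "x [^]\<^bsub>G\<lparr>carrier := H\<rparr>\<^esub> k = \<one>\<^bsub>G\<lparr>carrier := H\<rparr>\<^esub> \<longleftrightarrow> H.ord x dvd k"
      by (rule H.pow_eq_id) (use x(1) in simp)
    then show ?thesis unfolding nat_pow_consistent[of x _ H, symmetric] by simp
  qed
  then have "ord x = H.ord x"
    using ord_unique[OF xG] by blast
  moreover have "\<exists>k::nat. y = x [^] k" if "y \<in> H" for y
    unfolding nat_pow_consistent[of x _ H]
    by (rule H.powers_of_generator) (use x that fin in \<open>simp_all add: order_def\<close>)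
  ultimately show ?thesis using that x by simp
qed

text \<open>An endomorphism of a group of prime order raises a generator to some power \<open>v\<close>, and if its
  order divides \<open>n\<close> then \<open>v\<^sup>n \<equiv> 1\<close> modulo \<open>p\<close>. The coprimality of \<open>n\<close> and \<open>p - 1\<close> comes from the
  Burnside condition. Through this lemma it forces normal subgroups of prime order to be central, and
  \<open>\<alpha>\<close> to fix the elements of invariant ones.\<close>

lemma (in group) hom_eq_id_on_prime_order:
  fixes p n :: nat
  assumes p: "Factorial_Ring.prime p" "order G = p"
    and \<theta>: "\<theta> \<in> hom G G" "\<And>x. x \<in> carrier G \<Longrightarrow> (\<theta> ^^ n) x = x"
    and n: "n > 0" "coprime n (p - 1)" and x: "x \<in> carrier G"
  shows "\<theta> x = x"
proof -
  have fin: "finite (carrier G)"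
  proof -
    have "order G > 0" unfolding p(2) by (rule prime_gt_0_nat[OF p(1)])
    then show ?thesis by (simp add: order_gt_0_iff_finite)
  qed
  interpret \<theta>: group_hom G G \<theta>
    using \<theta>(1) by (simp add: group_hom_def group_hom_axioms_def is_group)
  obtain d where d: "d \<in> carrier G" "d \<noteq> \<one>"
  proof -
    have "card (carrier G) > 1" using prime_gt_1_nat[OF p(1)] p(2) by (simp add: order_def)
    then have "carrier G \<noteq> {\<one>}" by auto
    then show ?thesis using that one_closed by auto
  qed
  have ordd: "ord d = p"
    using ord_dvd_group_order[OF d(1)] ord_eq_1[OF d(1)] d(2) p unfolding prime_nat_iff by blast
  have gen: "\<exists>k::nat. y = d [^] k" if "y \<in> carrier G" for y
    by (rule powers_of_generator[OF fin d(1) _ that]) (simp only: ordd p(2))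
  obtain v :: nat where v: "\<theta> d = d [^] v"
    using gen[OF \<theta>.hom_closed[OF d(1)]] ..
  have iter: "(\<theta> ^^ k) d = d [^] (v ^ k)" for k
  proof (induction k)
    case (Suc k)
    then have "(\<theta> ^^ Suc k) d = (d [^] v) [^] (v ^ k)" using d(1) by (simp add: \<theta>.hom_nat_pow v)
    then show ?case using d(1) by (simp add: nat_pow_pow)
  qed (use d(1) in simp)
  have "d [^] (v ^ n) = d [^] (1::nat)"
    using iter[of n] \<theta>(2) d by simp
  then have "[v ^ n = 1] (mod p)"
    using nat_pow_eq_iff_cong[OF d(1)] ordd by blast
  then have "[v = 1] (mod p)" using pow_cong_1_coprime p n by blast
  then have "\<theta> d = d [^] (1::nat)"
    unfolding v using nat_pow_eq_iff_cong[OF d(1)] ordd by blast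
  then have "\<theta> d = d" using d by simp
  moreover obtain k :: nat where "x = d [^] k"
    using gen[OF x] ..
  ultimately show ?thesis using d by (simp add: \<theta>.hom_nat_pow)
qed

section \<open>Invariant subgroups and quotients of affine cycles\<close>

context affine_cycle begin

text \<open>The cosets \<open>x M\<close> are blocks for \<open>g\<close>, because \<open>g\<close> maps \<open>x M\<close> to the coset of \<open>g x\<close>. So the
  times at which the orbit of the identity visits \<open>M\<close> are the multiples of the first return time
  \<open>j\<close>, and \<open>g\<^sup>j\<close> runs through \<open>M\<close> in a single cycle.\<close>

lemma restrict_to_subgroup:
  assumes M: "subgroup M N" and inv: "\<alpha> ` M \<subseteq> M"
  shows "\<exists>j e. affine_cycle (N\<lparr>carrier := M\<rparr>) (\<alpha> ^^ j) e"
proof -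
  interpret M: subgroup M N by (rule M)
  have pow_M: "(\<alpha> ^^ k) x \<in> M" if "x \<in> M" for k x
    using that inv by (induction k) auto
  have M_cancel: "x \<in> M" if "x \<otimes> y \<in> M" "y \<in> M" "x \<in> carrier N" for x y
  proof -
    have "x = x \<otimes> y \<otimes> inv y" using that M.mem_carrier by (simp add: m_assoc)
    then show ?thesis using that M.m_closed M.m_inv_closed by metis
  qed
  define P where "P = (\<lambda>j. j > 0 \<and> s j \<in> M)"
  define j where "j = (LEAST j. P j)"
  have "P (order N)" using order_pos s_order by (simp add: P_def)
  then have j: "j > 0" "s j \<in> M" and least: "\<And>r. P r \<Longrightarrow> j \<le> r"
    unfolding j_def using LeastI[of P] Least_le[of P] by (auto simp: P_def)
  have block: "s (j * q) \<in> M" for q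
  proof (induction q)
    case (Suc q)
    have "s (j * Suc q) = s j \<otimes> (\<alpha> ^^ j) (s (j * q))" by (simp add: s_add)
    then show ?case using Suc j pow_M by simp
  qed simp
  have multiple: "\<exists>q. k = j * q" if "s k \<in> M" for k
  proof -
    have "s (k mod j + j * (k div j)) \<in> M" using that by simp
    then have "s (k mod j) \<otimes> (\<alpha> ^^ (k mod j)) (s (j * (k div j))) \<in> M"
      unfolding s_add .
    then have "s (k mod j) \<in> M" by (rule M_cancel) (simp_all add: pow_M block)
    moreover have "k mod j < j" using j by simp
    ultimately have "k mod j = 0" using least[of "k mod j"] unfolding P_def by linarith
    then show ?thesis by (metis dvd_def mod_0_imp_dvd)
  qed
  have iter: "((\<lambda>y. s j \<otimes> (\<alpha> ^^ j) y) ^^ q) \<one> = s (j * q)" for q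
    by (induction q) (simp_all add: s_add)
  have "affine_cycle (N\<lparr>carrier := M\<rparr>) (\<alpha> ^^ j) (s j)"
  proof (intro affine_cycle.intro affine_cycle_axioms.intro subgroup_imp_group M)
    show "finite (carrier (N\<lparr>carrier := M\<rparr>))"
      using finite_subset[OF M.subset fin] by simp
    show "\<alpha> ^^ j \<in> hom (N\<lparr>carrier := M\<rparr>) (N\<lparr>carrier := M\<rparr>)"
      by (rule homI) (simp_all add: pow_M \<alpha>_pow_mult M.mem_carrier)
    show "inj_on (\<alpha> ^^ j) (carrier (N\<lparr>carrier := M\<rparr>))"
      using inj_on_subset[OF \<alpha>_pow_inj M.subset] by simp
    show "s j \<in> carrier (N\<lparr>carrier := M\<rparr>)" using j by simp
    fix x assume "x \<in> carrier (N\<lparr>carrier := M\<rparr>)"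
    then have x: "x \<in> M" by simp
    obtain k where k: "x = s k" using s_surj[OF M.mem_carrier[OF x]] ..
    obtain q where "k = j * q" using multiple x k by blast
    then show "\<exists>k. ((\<lambda>y. s j \<otimes>\<^bsub>N\<lparr>carrier := M\<rparr>\<^esub> (\<alpha> ^^ j) y) ^^ k) \<one>\<^bsub>N\<lparr>carrier := M\<rparr>\<^esub> = x"
      using iter k by auto
  qed
  then show ?thesis by blast
qed

lemma invariant_subgroup_inj:
  assumes Q: "subgroup Q N" and inv: "\<alpha> ` Q \<subseteq> Q" and x: "x \<in> carrier N" "\<alpha> x \<in> Q"
  shows "x \<in> Q"
proof -
  have "finite Q" by (rule finite_subset[OF subgroup.subset[OF Q] fin])
  then have "\<alpha> ` Q = Q"
    using inj_on_subset[OF \<alpha>_inj subgroup.subset[OF Q]] inv by (intro endo_inj_surj) auto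
  then obtain y where y: "y \<in> Q" "\<alpha> x = \<alpha> y" using x(2) by blast
  then have "x = y" by (intro inj_onD[OF \<alpha>_inj y(2) x(1)] subgroup.mem_carrier[OF Q])
  then show ?thesis using y by simp
qed

text \<open>The quotient is realised on coset representatives, which keeps the element type \<open>'a\<close>. The
  induction on the order of the group needs this, as its hypothesis is available for one type only.\<close>

lemma quotient:
  assumes Q: "Q \<lhd> N" and inv: "\<alpha> ` Q \<subseteq> Q"
  obtains L :: "'a monoid" and \<pi> \<alpha>' c' where "group_hom N L \<pi>" "\<pi> ` carrier N = carrier L"
    "\<forall>x\<in>carrier N. \<forall>y\<in>carrier N. \<pi> x = \<pi> y \<longleftrightarrow> x \<otimes> inv y \<in> Q"
    "affine_cycle L \<alpha>' c'"
proof -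
  interpret Q: normal Q N by (rule Q)
  define \<pi> where "\<pi> x = (SOME y. y \<in> Q #> x)" for x
  have \<pi>_in: "\<pi> x \<in> Q #> x" if "x \<in> carrier N" for x
    unfolding \<pi>_def by (rule someI[of "\<lambda>y. y \<in> Q #> x"], rule rcos_self[OF that Q.subgroup_axioms])
  have \<pi>_eq: "\<pi> x = \<pi> y \<longleftrightarrow> x \<otimes> inv y \<in> Q" if xy: "x \<in> carrier N" "y \<in> carrier N" for x y
  proof -
    have "\<pi> x = \<pi> y \<longleftrightarrow> Q #> x = Q #> y"
    proof
      assume "\<pi> x = \<pi> y"
      then show "Q #> x = Q #> y"
        using repr_independence[OF \<pi>_in xy(1) Q.subgroup_axioms]
          repr_independence[OF \<pi>_in xy(2) Q.subgroup_axioms] xy by metis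
    qed (simp add: \<pi>_def)
    also have "\<dots> \<longleftrightarrow> x \<in> Q #> y"
      using repr_independence[OF _ xy(2) Q.subgroup_axioms] rcos_self[OF xy(1) Q.subgroup_axioms] by metis
    also have "\<dots> \<longleftrightarrow> x \<otimes> inv y \<in> Q"
      by (rule Q.rcos_module[OF is_group xy(2) xy(1)])
    finally show ?thesis .
  qed
  have w: "weak_group_morphism \<pi> Q N"
    by (rule weak_group_morphismsI[OF Q]) (rule \<pi>_eq)
  define L where "L = image_group \<pi> N"
  have hom: "group_hom N L \<pi>" unfolding L_def by (rule weak_group_morphism_group_hom[OF w])
  interpret \<pi>: group_hom N L \<pi> by (rule hom)
  have carr: "\<pi> ` carrier N = carrier L" by (simp add: L_def image_group_carrier)
  define \<alpha>' where "\<alpha>' a = \<pi> (\<alpha> (inv_into (carrier N) \<pi> a))" for a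
  have \<alpha>_inv: "\<alpha> (x \<otimes> inv y) = \<alpha> x \<otimes> inv (\<alpha> y)" if "x \<in> carrier N" "y \<in> carrier N" for x y
    using that \<alpha>_pow_inv[of y 1] by (simp add: \<alpha>_mult)
  have \<alpha>': "\<alpha>' (\<pi> x) = \<pi> (\<alpha> x)" if x: "x \<in> carrier N" for x
  proof -
    define y where "y = inv_into (carrier N) \<pi> (\<pi> x)"
    have y: "y \<in> carrier N" "\<pi> y = \<pi> x"
      using x by (auto simp: y_def inv_into_into f_inv_into_f)
    then have "y \<otimes> inv x \<in> Q" using \<pi>_eq x by blast
    then have "\<alpha> y \<otimes> inv (\<alpha> x) \<in> Q" using inv \<alpha>_inv[OF y(1) x] by (metis image_subset_iff)
    then show ?thesis using \<pi>_eq x y by (simp add: \<alpha>'_def flip: y_def)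
  qed
  have "affine_cycle L \<alpha>' (\<pi> c)"
  proof (intro affine_cycle.intro affine_cycle_axioms.intro)
    show "group L" by (rule \<pi>.H.is_group)
    show "finite (carrier L)" using fin by (simp flip: carr)
    show "\<alpha>' \<in> hom L L"
    proof (rule homI)
      fix a assume "a \<in> carrier L"
      then obtain x where "x \<in> carrier N" "a = \<pi> x" using carr by blast
      then show "\<alpha>' a \<in> carrier L" by (simp add: \<alpha>')
      fix b assume "b \<in> carrier L"
      then obtain y where "y \<in> carrier N" "b = \<pi> y" using carr by blast
      with \<open>x \<in> carrier N\<close> \<open>a = \<pi> x\<close> show "\<alpha>' (a \<otimes>\<^bsub>L\<^esub> b) = \<alpha>' a \<otimes>\<^bsub>L\<^esub> \<alpha>' b"
        using \<alpha>'[of "x \<otimes> y"] by (simp add: \<alpha>' \<alpha>_mult)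
    qed
    show "inj_on \<alpha>' (carrier L)"
    proof (rule inj_onI)
      fix a b assume "a \<in> carrier L" "b \<in> carrier L" and eq: "\<alpha>' a = \<alpha>' b"
      then obtain x y where xy: "x \<in> carrier N" "a = \<pi> x" "y \<in> carrier N" "b = \<pi> y"
        using carr by blast
      then have "\<pi> (\<alpha> x) = \<pi> (\<alpha> y)" using eq by (simp add: \<alpha>')
      then have "\<alpha> (x \<otimes> inv y) \<in> Q" using \<pi>_eq xy \<alpha>_inv by simp
      from _ this have "x \<otimes> inv y \<in> Q"
        by (rule invariant_subgroup_inj[OF Q.subgroup_axioms inv]) (use xy in simp)
      then show "a = b" using \<pi>_eq xy by simp
    qed
    show "\<pi> c \<in> carrier L" by simp
    have iter: "((\<lambda>y. \<pi> c \<otimes>\<^bsub>L\<^esub> \<alpha>' y) ^^ k) \<one>\<^bsub>L\<^esub> = \<pi> (s k)" for k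
      by (induction k) (simp_all add: \<alpha>' s_Suc)
    fix a assume "a \<in> carrier L"
    then obtain x where x: "x \<in> carrier N" "a = \<pi> x" using carr by blast
    obtain k where "x = s k" using s_surj[OF x(1)] ..
    then show "\<exists>k. ((\<lambda>y. \<pi> c \<otimes>\<^bsub>L\<^esub> \<alpha>' y) ^^ k) \<one>\<^bsub>L\<^esub> = a"
      using iter[of k] x(2) by blast
  qed
  with \<pi>_eq show ?thesis by (intro that[OF hom carr]) simp_all
qed

lemma cyclic_if_trivial:
  assumes "\<And>x. x \<in> carrier N \<Longrightarrow> \<alpha> x = x"
  shows "cyclic N"
proof (rule cyclicI[OF fin c_closed])
  have s: "s k = c [^] k" for k
  proof (induction k)
    case (Suc k)
    have "c [^] Suc k = c \<otimes> c [^] k" by (rule nat_pow_Suc2[OF c_closed])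
    then show ?case by (simp only: s_Suc Suc.IH assms nat_pow_closed[OF c_closed])
  qed simp
  fix y assume "y \<in> carrier N"
  then show "\<exists>k::nat. y = c [^] k" using s_surj[of y] s by auto
qed

lemma fixed_point_imp_trivial:
  assumes x: "x \<in> carrier N" and fp: "c \<otimes> \<alpha> x = x"
  shows "order N = 1"
proof -
  obtain k where k: "x = s k" using s_surj[OF x] ..
  then have "s (k + 1) = s k" using fp by (simp add: s_Suc)
  then have "(\<alpha> ^^ k) (s 1) = (\<alpha> ^^ k) \<one>" unfolding s_add by simp
  then have "s 1 = \<one>" by (rule inj_onD[OF \<alpha>_pow_inj]) simp_all
  then show ?thesis using order_le_period[of 1] order_pos by simp
qed

text \<open>In an abelian group \<open>\<delta> 1\<close> is an endomorphism. If it were surjective, then \<open>\<delta> 1 x\<close> would be the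
  inverse of \<open>c\<close> for some \<open>x\<close>, and this \<open>x\<close> would be a fixed point of \<open>g\<close>.\<close>

lemma image_\<delta>_subgroup:
  assumes comm: "\<And>x y. x \<in> carrier N \<Longrightarrow> y \<in> carrier N \<Longrightarrow> x \<otimes> y = y \<otimes> x"
  shows "subgroup (\<delta> 1 ` carrier N) N" "\<alpha> ` \<delta> 1 ` carrier N \<subseteq> \<delta> 1 ` carrier N"
    and "order N \<noteq> 1 \<Longrightarrow> \<delta> 1 ` carrier N \<noteq> carrier N"
proof -
  have "\<delta> 1 \<in> hom N N"
  proof (rule homI)
    fix x y assume xy: "x \<in> carrier N" "y \<in> carrier N"
    interpret comm_group N using comm by (rule group_comm_groupI)
    show "\<delta> 1 (x \<otimes> y) = \<delta> 1 x \<otimes> \<delta> 1 y"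
      using xy by (simp add: \<delta>_def \<alpha>_mult inv_mult m_ac)
  qed simp
  then interpret \<delta>: group_hom N N "\<delta> 1"
    by (simp add: group_hom_def group_hom_axioms_def is_group)
  show "subgroup (\<delta> 1 ` carrier N) N" by (rule \<delta>.img_is_subgroup)
  show "\<alpha> ` \<delta> 1 ` carrier N \<subseteq> \<delta> 1 ` carrier N"
    using \<alpha>_\<delta>[of _ 1 1] by auto
  show "\<delta> 1 ` carrier N \<noteq> carrier N" if "order N \<noteq> 1"
  proof
    assume "\<delta> 1 ` carrier N = carrier N"
    then have "inv c \<in> \<delta> 1 ` carrier N" by simp
    then obtain x where x: "x \<in> carrier N" "inv c = \<delta> 1 x" by blast
    have "c \<otimes> \<alpha> x = c \<otimes> (\<delta> 1 x \<otimes> x)" using x(1) by (simp add: \<delta>_def m_assoc)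
    also have "\<dots> = x" unfolding x(2)[symmetric] using x(1) by (simp add: m_assoc[symmetric])
    finally have "c \<otimes> \<alpha> x = x" .
    then show False using fixed_point_imp_trivial x(1) that by blast
  qed
qed

text \<open>If \<open>\<alpha>\<close> is the identity, then \<open>N\<close> consists of the powers of \<open>c\<close>. Otherwise \<open>D\<close> is not trivial, and
  it can be taken unless it is all of \<open>N\<close>. In that case \<open>N\<close> is abelian, and the image of \<open>\<delta> 1\<close> is a
  proper subgroup.\<close>

lemma proper_invariant_normal_subgroup:
  assumes "\<not> cyclic N"
  obtains M where "M \<lhd> N" "\<alpha> ` M \<subseteq> M" "M \<noteq> {\<one>}" "M \<noteq> carrier N"
proof -
  obtain x where x: "x \<in> carrier N" "\<alpha> x \<noteq> x"
    using cyclic_if_trivial assms by blast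
  have \<delta>x: "\<delta> 1 x \<noteq> \<one>" 
    using x inv_equality[of "\<alpha> x" "inv x"] by (auto simp: \<delta>_def)
  show ?thesis
  proof (cases "D = carrier N")
    case False
    have "D \<noteq> {\<one>}" using \<delta>x \<delta>_in_D[OF x(1), of 1] by auto
    then show ?thesis by (intro that[OF D_normal D_invariant _ False])
  next
    case True
    have comm: "y \<otimes> z = z \<otimes> y" if "y \<in> carrier N" "z \<in> carrier N" for y z
      using D_comm[of y z] that unfolding True by simp
    have "order N \<noteq> 1"
    proof
      assume "order N = 1"
      then have "carrier N = {\<one>}" by (simp only: order_one_triv_iff)
      then show False using \<delta>x \<delta>_closed[OF x(1), of 1] by simp
    qed
    moreover have "\<delta> 1 ` carrier N \<lhd> N"
    proof (rule normal_invI[OF image_\<delta>_subgroup(1)[OF comm]])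
      fix y z assume y: "y \<in> carrier N" and z: "z \<in> \<delta> 1 ` carrier N"
      then have "y \<otimes> z \<otimes> inv y = z"
        using comm[of y z] by (auto simp: m_assoc)
      then show "y \<otimes> z \<otimes> inv y \<in> \<delta> 1 ` carrier N" using z by simp
    qed
    moreover have "\<delta> 1 ` carrier N \<noteq> {\<one>}" using \<delta>x x(1) by blast
    ultimately show ?thesis
      by (intro that[of "\<delta> 1 ` carrier N"] image_\<delta>_subgroup(2,3)[OF comm])
  qed
qed

end

section \<open>Groups with an affine cycle are cyclic\<close>

lemma (in group) pow_eq_one_of_card:
  assumes "subgroup Q G" "x \<in> Q"
  shows "x [^] card Q = \<one>"
proof -
  interpret H: group "G\<lparr>carrier := Q\<rparr>" by (rule subgroup_imp_group[OF assms(1)])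
  have "x [^]\<^bsub>G\<lparr>carrier := Q\<rparr>\<^esub> order (G\<lparr>carrier := Q\<rparr>) = \<one>\<^bsub>G\<lparr>carrier := Q\<rparr>\<^esub>"
    by (rule H.pow_order_eq_1) (use assms(2) in simp)
  then show ?thesis by (simp add: order_def flip: nat_pow_consistent)
qed

text \<open>The subgroup of order \<open>p\<close> in a cyclic group is described by the equation \<open>x\<^sup>p = 1\<close>, which
  makes it invariant under automorphisms and conjugation whenever the cyclic group is.\<close>

lemma (in group) prime_torsion_of_cyclic:
  assumes fin: "finite (carrier G)" and M: "subgroup M G" "cyclic (G\<lparr>carrier := M\<rparr>)"
    and p: "Factorial_Ring.prime p" "p dvd card M"
  shows "subgroup {x \<in> M. x [^] p = \<one>} G" "card {x \<in> M. x [^] p = \<one>} = p"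
proof -
  obtain e where e: "e \<in> M" "ord e = card M" and gen: "\<And>y. y \<in> M \<Longrightarrow> \<exists>k::nat. y = e [^] k"
    using cyclic_subgroupE[OF fin M] by metis
  interpret M: subgroup M G by (rule M(1))
  have eG [simp]: "e \<in> carrier G" by (rule M.mem_carrier[OF e(1)])
  obtain m where m: "card M = p * m" using p(2) by blast
  have "card M > 0" using ord_ge_1[OF fin eG] e(2) by simp
  then have m0: "m > 0" "p > 0" using m by auto
  define f where "f = e [^] m"
  have fG [simp]: "f \<in> carrier G" by (simp add: f_def)
  have ordf: "ord f = p"
    unfolding f_def using ord_pow[OF eG, of m] e(2) m m0 by simp
  have pow_M: "e [^] k \<in> M" for k :: nat
    by (induction k) (simp_all add: e(1))
  have "{x \<in> M. x [^] p = \<one>} = generate G {f}"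
    unfolding generate_pow_on_finite_carrier[OF fin fG]
  proof (intro equalityI subsetI)
    fix x assume "x \<in> {x \<in> M. x [^] p = \<one>}"
    then have x: "x \<in> M" "x [^] p = \<one>" by auto
    obtain k :: nat where k: "x = e [^] k" using gen[OF x(1)] ..
    have "e [^] (k * p) = \<one>" using x(2) by (simp add: k nat_pow_pow)
    then have "p * m dvd k * p" using pow_eq_id[OF eG] e(2) m by simp
    then have "m dvd k" using m0 by (simp add: mult.commute)
    then obtain l where "k = m * l" by blast
    then have "x = f [^] l" by (simp add: k f_def nat_pow_pow)
    then show "x \<in> {f [^] k |k. k \<in> (UNIV :: nat set)}" by blast
  next
    fix x assume "x \<in> {f [^] k |k. k \<in> (UNIV :: nat set)}"
    then obtain k :: nat where k: "x = f [^] k" by blast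
    have "f [^] (k * p) = \<one>" using pow_eq_id[OF fG] ordf by simp
    then show "x \<in> {x \<in> M. x [^] p = \<one>}"
      using pow_M[of "m * k"] by (simp add: k nat_pow_pow f_def mult.assoc)
  qed
  then show "subgroup {x \<in> M. x [^] p = \<one>} G" "card {x \<in> M. x [^] p = \<one>} = p"
    using generate_is_subgroup[of "{f}"] generate_pow_card[OF fG] ordf by simp_all
qed

lemma (in group) normal_prime_order_central:
  assumes fin: "finite (carrier G)" and Q: "Q \<lhd> G"
    and p: "Factorial_Ring.prime p" "card Q = p" "coprime (order G) (p - 1)"
    and x: "x \<in> carrier G" and q: "q \<in> Q"
  shows "x \<otimes> q = q \<otimes> x"
proof -
  interpret Q: normal Q G by (rule Q)
  interpret H: group "G\<lparr>carrier := Q\<rparr>" by (rule subgroup_imp_group[OF Q.subgroup_axioms])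
  define \<theta> where "\<theta> y = x \<otimes> y \<otimes> inv x" for y
  have iter: "(\<theta> ^^ k) y = x [^] k \<otimes> y \<otimes> inv (x [^] k)" if y: "y \<in> carrier G" for k y
  proof (induction k)
    case (Suc k)
    have "x [^] Suc k = x \<otimes> x [^] k" by (rule nat_pow_Suc2[OF x])
    then show ?case using x y Suc by (simp add: \<theta>_def m_assoc inv_mult_group del: nat_pow_Suc)
  qed (use y in simp)
  have "\<theta> q = q"
  proof (rule H.hom_eq_id_on_prime_order[OF p(1), of \<theta> "order G"])
    show "order (G\<lparr>carrier := Q\<rparr>) = p" using p(2) by (simp add: order_def)
    show "\<theta> \<in> hom (G\<lparr>carrier := Q\<rparr>) (G\<lparr>carrier := Q\<rparr>)"
    proof (rule homI)
      show "\<theta> y \<in> carrier (G\<lparr>carrier := Q\<rparr>)" if "y \<in> carrier (G\<lparr>carrier := Q\<rparr>)" for y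
        using Q.inv_op_closed2[OF x] that by (simp add: \<theta>_def)
      show "\<theta> (y \<otimes>\<^bsub>G\<lparr>carrier := Q\<rparr>\<^esub> z) = \<theta> y \<otimes>\<^bsub>G\<lparr>carrier := Q\<rparr>\<^esub> \<theta> z"
        if "y \<in> carrier (G\<lparr>carrier := Q\<rparr>)" "z \<in> carrier (G\<lparr>carrier := Q\<rparr>)" for y z
        using that x Q.mem_carrier by (simp add: \<theta>_def m_assoc inv_solve_left)
    qed
    show "(\<theta> ^^ order G) y = y" if "y \<in> carrier (G\<lparr>carrier := Q\<rparr>)" for y
      using iter[of y "order G"] pow_order_eq_1[OF x] Q.mem_carrier[of y] that by simp
    show "order G > 0" using fin by (simp only: order_gt_0_iff_finite)
    show "coprime (order G) (p - 1)" by (rule p(3))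
    show "q \<in> carrier (G\<lparr>carrier := Q\<rparr>)" using q by simp
  qed
  then have "x \<otimes> q \<otimes> inv x \<otimes> x = q \<otimes> x" unfolding \<theta>_def by simp
  then show ?thesis using x Q.mem_carrier[OF q] by (simp add: m_assoc)
qed

lemma (in affine_cycle) prime_order_fixed:
  assumes p: "Factorial_Ring.prime p" "card Q = p" "coprime (order N) (p - 1)"
    and Q: "subgroup Q N" "\<alpha> ` Q \<subseteq> Q" and x: "x \<in> Q"
  shows "\<alpha> x = x"
proof -
  interpret Q: subgroup Q N by (rule Q)
  interpret H: group "N\<lparr>carrier := Q\<rparr>" by (rule subgroup_imp_group[OF Q(1)])
  show ?thesis
  proof (rule H.hom_eq_id_on_prime_order[OF p(1), of \<alpha> "order N"])
    show "order (N\<lparr>carrier := Q\<rparr>) = p" using p(2) by (simp add: order_def)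
    show "\<alpha> \<in> hom (N\<lparr>carrier := Q\<rparr>) (N\<lparr>carrier := Q\<rparr>)"
      by (rule homI) (use Q(2) in \<open>auto simp: \<alpha>_mult\<close>)
    show "(\<alpha> ^^ order N) y = y" if "y \<in> carrier (N\<lparr>carrier := Q\<rparr>)" for y
      using \<alpha>_pow_order[of y 1] Q.mem_carrier[of y] that by simp
  qed (use order_pos p(3) x in simp_all)
qed

text \<open>The element \<open>y\<close> stands for a generator of \<open>N\<close> modulo \<open>Q\<close>. If \<open>y\<close> does not generate \<open>N\<close>, then \<open>Q\<close> is
  complementary to \<open>\<langle>y\<rangle>\<close>. For \<open>p\<close> not dividing \<open>m\<close> a generator is \<open>y\<close> times a generator of \<open>Q\<close>.

  For \<open>p\<close> dividing \<open>m\<close> there are too many solutions of \<open>x\<^sup>p = 1\<close> for them to form a cyclic group, so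
  by the induction hypothesis they fill all of \<open>N\<close>. The image of
  \<open>\<delta> 1\<close> is a proper subgroup, so it is cyclic and hence of order at most \<open>p\<close>, and \<open>\<alpha>\<close> fixes its
  elements. Now \<open>\<alpha> c = b c\<close> with \<open>\<alpha> b = b\<close>, so \<open>s p\<close> is \<open>c\<^sup>p\<close> times the power of \<open>b\<close> with exponent
  \<open>p (p - 1) / 2\<close>. As \<open>p\<close> is odd, both factors vanish, and the cycle has length at most \<open>p\<close>. The
  oddness of \<open>p\<close> is essential: on the Klein four-group there is an affine cycle of length four.\<close>

lemma (in affine_cycle) cyclic_if_abelian:
  assumes comm: "\<And>x y. x \<in> carrier N \<Longrightarrow> y \<in> carrier N \<Longrightarrow> x \<otimes> y = y \<otimes> x"
    and odd: "odd (order N)"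
    and p: "Factorial_Ring.prime p" "order N = p * m" "coprime (order N) (p - 1)"
    and Q: "subgroup Q N" "card Q = p"
    and y [simp]: "y \<in> carrier N" and y_pow: "\<And>k::nat. y [^] k \<in> Q \<longleftrightarrow> m dvd k"
    and IH: "\<And>M. subgroup M N \<Longrightarrow> \<alpha> ` M \<subseteq> M \<Longrightarrow> M \<noteq> carrier N \<Longrightarrow> cyclic (N\<lparr>carrier := M\<rparr>)"
  shows "cyclic N"
proof -
  interpret comm_group N using comm by (rule group_comm_groupI)
  interpret Q: subgroup Q N by (rule Q)
  interpret \<alpha>: group_hom N N \<alpha>
    using \<alpha>_hom by (simp add: group_hom_def group_hom_axioms_def is_group)
  have p0: "p > 1" "p > 0" and m0: "m > 0"
    using prime_gt_1_nat[OF p(1)] order_pos p(2) by auto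
  have cyclic_if: "cyclic N"
    if z: "z \<in> carrier N" and dvd: "\<And>k::nat. z [^] k = \<one> \<Longrightarrow> p * m dvd k" for z
  proof -
    have "ord z = order N"
      using dvd[OF pow_ord_eq_1[OF z]] ord_dvd_group_order[OF z] unfolding p(2) by (intro dvd_antisym)
    then show ?thesis using z by (auto simp: cyclic_def)
  qed
  have ord_Q: "ord x = p" if "x \<in> Q" "x \<noteq> \<one>" for x
  proof -
    have x: "x \<in> carrier N" by (rule Q.mem_carrier[OF that(1)])
    have "ord x dvd p" using pow_eq_one_of_card[OF Q(1) that(1)] pow_eq_id[OF x] Q(2) by simp
    moreover have "ord x \<noteq> 1" using ord_eq_1[OF x] that(2) by simp
    ultimately show ?thesis using p(1) unfolding prime_nat_iff by blast
  qed
  show ?thesis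
  proof (cases "y [^] m = \<one>")
    case False
    have "y [^] m \<in> Q" using y_pow by simp
    note ord_ym = ord_Q[OF this False]
    show ?thesis
    proof (rule cyclic_if[OF y])
      fix k :: nat assume k: "y [^] k = \<one>"
      then have "m dvd k" using y_pow[of k] by simp
      then obtain l where l: "k = m * l" by blast
      then have "(y [^] m) [^] l = \<one>" using k by (simp add: nat_pow_pow)
      then have "p dvd l" using pow_eq_id[of "y [^] m" l] ord_ym by simp
      then show "p * m dvd k" unfolding l by (simp add: mult.commute)
    qed
  next
    case ym: True
    obtain d where d: "d \<in> Q" "d \<noteq> \<one>"
    proof -
      have "Q \<noteq> {\<one>}" using Q(2) p0 by auto
      then show ?thesis using that Q.one_closed by blast
    qed
    have dN [simp]: "d \<in> carrier N" by (rule Q.mem_carrier[OF d(1)])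
    have pow_Q: "d [^] k \<in> Q" for k :: nat by (induction k) (simp_all add: d(1))
    show ?thesis
    proof (cases "p dvd m")
      case False
      show ?thesis
      proof (rule cyclic_if)
        show "y \<otimes> d \<in> carrier N" by simp
        fix k :: nat assume "(y \<otimes> d) [^] k = \<one>"
        then have yd: "y [^] k \<otimes> d [^] k = \<one>" by (simp add: nat_pow_distrib)
        then have "y [^] k = inv (d [^] k)" using inv_equality[of "y [^] k" "d [^] k"] by simp
        then have "y [^] k \<in> Q" using pow_Q by simp
        then have mk: "m dvd k" using y_pow by blast
        then have "y [^] k = \<one>" using ym by (auto simp flip: nat_pow_pow)
        then have "d [^] k = \<one>" using yd by simp
        then have "p dvd k" using pow_eq_id[OF dN] ord_Q[OF d] by simp
        moreover have "coprime p m" using False p(1) prime_imp_coprime by blast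
        ultimately show "p * m dvd k" using mk by (intro divides_mult)
      qed
    next
      case True
      then obtain l where l: "m = p * l" by blast
      then have l0: "l > 0" "l < m" using m0 p0 by auto
      define E where "E = {x \<in> carrier N. x [^] p = \<one>}"
      have E: "subgroup E N"
      proof (rule subgroupI)
        show "E \<noteq> {}" using one_closed nat_pow_one by (auto simp: E_def)
      qed (auto simp: E_def nat_pow_distrib nat_pow_inv)
      have E_inv: "\<alpha> ` E \<subseteq> E" by (auto simp: E_def simp flip: \<alpha>.hom_nat_pow)
      have fin_E: "finite E" using fin by (simp add: E_def)
      have card_dvd: "card S dvd p" if S: "subgroup S N" "\<alpha> ` S \<subseteq> S" "S \<noteq> carrier N" "S \<subseteq> E" for S
      proof -
        obtain e where e: "e \<in> S" "ord e = card S"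
          using cyclic_subgroupE[OF fin S(1) IH[OF S(1-3)]] by metis
        then have "e \<in> carrier N" "e [^] p = \<one>" using S(4) by (auto simp: E_def)
        then show ?thesis using pow_eq_id e(2) by metis
      qed
      have "E = carrier N"
      proof (rule ccontr)
        assume "E \<noteq> carrier N"
        then have "card E dvd p" by (intro card_dvd[OF E E_inv]) auto
        then have "card E \<le> p" using p0 by (intro dvd_imp_le)
        moreover have QE: "Q \<subseteq> E"
          using pow_eq_one_of_card[OF Q(1)] Q(2) by (auto simp: E_def)
        ultimately have "Q = E" using Q(2) by (intro card_seteq[OF fin_E QE]) simp
        moreover have "y [^] l \<in> E" using ym by (simp add: E_def nat_pow_pow l mult.commute)
        ultimately have "m dvd l" using y_pow by blast
        then show False using l0 by (auto dest: dvd_imp_le)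
      qed
      define I where "I = \<delta> 1 ` carrier N"
      have "order N \<noteq> 1" using p(2) p0 by auto
      note I = image_\<delta>_subgroup[OF comm, folded I_def]
      have I_proper: "I \<noteq> carrier N" by (rule I(3)) (assumption | rule \<open>order N \<noteq> 1\<close>)+
      have "card I dvd p"
        using card_dvd[OF I(1,2) I_proper] \<open>E = carrier N\<close> subgroup.subset[OF I(1)] by simp
      then have cardI: "card I = 1 \<or> card I = p" using p(1) unfolding prime_nat_iff by blast
      define b where "b = \<delta> 1 c"
      have bI: "b \<in> I" by (simp add: b_def I_def)
      have bN [simp]: "b \<in> carrier N" by (simp add: b_def)
      have \<alpha>b: "\<alpha> b = b"
        using cardI
      proof
        assume "card I = p"
        then show ?thesis by (rule prime_order_fixed[OF p(1) _ p(3) I(1,2) bI])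
      next
        assume "card I = 1"
        then have "b = \<one>"
          using bI subgroup.one_closed[OF I(1)] by (auto simp: card_1_singleton_iff)
        then show ?thesis by simp
      qed
      have \<alpha>c: "\<alpha> c = b \<otimes> c" by (simp add: b_def \<delta>_def m_assoc)
      have s_formula: "s k = c [^] k \<otimes> b [^] (\<Sum>i<k. i)" for k
      proof (induction k)
        case (Suc k)
        have "s (Suc k) = c \<otimes> ((b \<otimes> c) [^] k \<otimes> b [^] (\<Sum>i<k. i))"
          by (simp add: s_Suc Suc \<alpha>_mult \<alpha>.hom_nat_pow \<alpha>b \<alpha>c)
        also have "\<dots> = c [^] Suc k \<otimes> b [^] (\<Sum>i<Suc k. i)"
          by (simp add: nat_pow_distrib nat_pow_mult[symmetric] m_ac)
        finally show ?case .
      qed simp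
      have exp: "x [^] p = \<one>" if "x \<in> carrier N" for x
        using that \<open>E = carrier N\<close> by (auto simp: E_def)
      have "odd p" using odd p(2) by simp
      then obtain h where h: "p = Suc (2 * h)" by (metis oddE Suc_eq_plus1)
      have "(\<Sum>i<Suc (2 * h). i) = Suc (2 * h) * h"
        by (induction h) auto
      then have "(\<Sum>i<p. i) = p * h" unfolding h .
      then have "s p = \<one>"
        unfolding s_formula by (simp add: exp flip: nat_pow_pow)
      then have "order N \<le> p" using order_le_period p0 by simp
      then show ?thesis using p(2) p0 l l0 by simp
    qed
  qed
qed

text \<open>A proper invariant normal subgroup \<open>M\<close> is cyclic by the induction hypothesis, so it contains an
  invariant normal subgroup \<open>Q\<close> of prime order \<open>p\<close>. The coprimality assumption makes \<open>Q\<close> central. The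
  quotient by \<open>Q\<close> is cyclic by the induction hypothesis again. A group that is cyclic modulo a
  central subgroup is abelian, which leaves the abelian case.\<close>

lemma affine_cycle_cyclic_step:
  fixes N :: "'a monoid" (structure)
  assumes cycle: "affine_cycle N \<alpha> c" and odd_N: "odd (order N)"
    and coprime_N: "\<And>p. Factorial_Ring.prime p \<Longrightarrow> p dvd order N \<Longrightarrow> coprime (order N) (p - 1)"
    and smaller: "\<And>(L :: 'a monoid) \<beta> d. order L < order N \<Longrightarrow> affine_cycle L \<beta> d \<Longrightarrow> odd (order L) \<Longrightarrow>
      (\<And>p. Factorial_Ring.prime p \<Longrightarrow> p dvd order L \<Longrightarrow> coprime (order L) (p - 1)) \<Longrightarrow> cyclic L"
  shows "cyclic N"
proof -
  interpret affine_cycle N \<alpha> c by (rule cycle)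
  have hereditary: "odd k" "\<And>p. Factorial_Ring.prime p \<Longrightarrow> p dvd k \<Longrightarrow> coprime k (p - 1)"
    if "k dvd order N" for k
  proof -
    show "odd k" using that odd_N by (auto dest: dvd_trans)
    fix p assume "Factorial_Ring.prime p" "p dvd k"
    then have "coprime (order N) (p - 1)" using coprime_N that dvd_trans by blast
    then show "coprime k (p - 1)" by (rule coprime_divisors[OF that dvd_refl])
  qed
  have card_dvd: "card M dvd order N" if "subgroup M N" for M
    using lagrange[OF that] by (metis dvd_triv_right)
  have IH: "cyclic (N\<lparr>carrier := M\<rparr>)" if M: "subgroup M N" "\<alpha> ` M \<subseteq> M" "M \<noteq> carrier N" for M
  proof -
    obtain j e where cyc: "affine_cycle (N\<lparr>carrier := M\<rparr>) (\<alpha> ^^ j) e"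
      using restrict_to_subgroup[OF M(1,2)] by blast
    have ord: "order (N\<lparr>carrier := M\<rparr>) = card M" by (simp add: order_def)
    have "card M < order N"
      unfolding order_def using subgroup.subset[OF M(1)] M(3) by (intro psubset_card_mono[OF fin]) blast
    then show ?thesis
      by (intro smaller[OF _ cyc, unfolded ord] hereditary[OF card_dvd[OF M(1)]])
  qed
  show ?thesis
  proof (rule ccontr)
    assume not_cyclic: "\<not> cyclic N"
    obtain M where M: "M \<lhd> N" "\<alpha> ` M \<subseteq> M" "M \<noteq> {\<one>}" "M \<noteq> carrier N"
      by (rule proper_invariant_normal_subgroup[OF not_cyclic])
    interpret M: normal M N by (rule M(1))
    have cycM: "cyclic (N\<lparr>carrier := M\<rparr>)" by (rule IH[OF M.subgroup_axioms M(2,4)])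
    have "card M \<noteq> 1"
    proof
      assume "card M = 1"
      then obtain x where x: "M = {x}" by (rule card_1_singletonE)
      then have "\<one> = x" using M.one_closed by simp
      then show False using M(3) x by simp
    qed
    then obtain p where p: "Factorial_Ring.prime p" "p dvd card M" using prime_factor_nat by blast
    have pN: "p dvd order N" using p(2) card_dvd[OF M.subgroup_axioms] by (rule dvd_trans)
    have cop: "coprime (order N) (p - 1)" by (rule coprime_N[OF p(1) pN])
    define Q where "Q = {x \<in> M. x [^] p = \<one>}"
    note Q = prime_torsion_of_cyclic[OF fin M.subgroup_axioms cycM p, folded Q_def]
    interpret Q: subgroup Q N by (rule Q(1))
    interpret \<alpha>: group_hom N N \<alpha>
      using \<alpha>_hom by (simp add: group_hom_def group_hom_axioms_def is_group)
    have Q_inv: "\<alpha> ` Q \<subseteq> Q"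
    proof clarify
      fix x assume "x \<in> Q"
      then have "x \<in> M" "x [^] p = \<one>" by (auto simp: Q_def)
      moreover have "\<alpha> x [^] p = \<alpha> (x [^] p)" using \<open>x \<in> M\<close> by (simp add: \<alpha>.hom_nat_pow)
      ultimately show "\<alpha> x \<in> Q" using M(2) by (auto simp: Q_def)
    qed
    have Q_normal: "Q \<lhd> N"
    proof (rule normal_invI[OF Q(1)])
      fix x q assume x: "x \<in> carrier N" and "q \<in> Q"
      then have q: "q \<in> M" "q [^] p = \<one>" "q \<in> carrier N" by (auto simp: Q_def)
      have "(x \<otimes> q \<otimes> inv x) [^] k = x \<otimes> q [^] k \<otimes> inv x" for k :: nat
      proof (induction k)
        case (Suc k)
        then show ?case using x q by (simp add: m_assoc inv_solve_left')
      qed (use x in simp)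
      then show "x \<otimes> q \<otimes> inv x \<in> Q"
        using M.inv_op_closed2[OF x q(1)] x q by (simp add: Q_def)
    qed
    have central: "x \<otimes> q = q \<otimes> x" if "x \<in> carrier N" "q \<in> Q" for x q
      by (rule normal_prime_order_central[OF fin Q_normal p(1) Q(2) cop that])
    obtain L :: "'a monoid" and \<pi> \<alpha>' c' where hom: "group_hom N L \<pi>"
      and surj: "\<pi> ` carrier N = carrier L"
      and \<pi>_iff: "\<forall>x\<in>carrier N. \<forall>y\<in>carrier N. \<pi> x = \<pi> y \<longleftrightarrow> x \<otimes> inv y \<in> Q"
      and cyc: "affine_cycle L \<alpha>' c'"
      by (rule quotient[OF Q_normal Q_inv])
    have \<pi>_eq: "\<pi> x = \<pi> y \<longleftrightarrow> x \<otimes> inv y \<in> Q" if "x \<in> carrier N" "y \<in> carrier N" for x y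
      using \<pi>_iff that by simp
    interpret L: affine_cycle L \<alpha>' c' by (rule cyc)
    interpret \<pi>: group_hom N L \<pi> by (rule hom)
    have \<pi>_one: "\<pi> x = \<one>\<^bsub>L\<^esub> \<longleftrightarrow> x \<in> Q" if "x \<in> carrier N" for x
      using \<pi>_eq[OF that one_closed] that by simp
    define m where "m = order L"
    have m: "order N = p * m"
    proof -
      have "kernel N L \<pi> = Q" using \<pi>_one Q.mem_carrier by (auto simp: kernel_def)
      then have "N Mod Q \<cong> L" using \<pi>.FactGroup_iso[OF surj] by simp
      then have "card (rcosets Q) = m"
        using iso_same_card[of "N Mod Q" L] by (simp add: m_def order_def FactGroup_def)
      then show ?thesis using lagrange[OF Q(1)] Q(2) by (simp add: mult.commute)
    qed
    have "m < order N" using m L.order_pos prime_gt_1_nat[OF p(1)] by (simp add: m_def)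
    moreover have "m dvd order N" by (simp add: m)
    ultimately have "cyclic L"
      by (intro smaller[OF _ cyc, folded m_def] hereditary[of m])
    then obtain a where a: "a \<in> carrier L" "L.ord a = m" by (auto simp: cyclic_def m_def)
    then obtain y where y: "y \<in> carrier N" "a = \<pi> y" using surj by blast
    have y_pow: "y [^] k \<in> Q \<longleftrightarrow> m dvd k" for k :: nat
    proof -
      have "y [^] k \<in> Q \<longleftrightarrow> a [^]\<^bsub>L\<^esub> k = \<one>\<^bsub>L\<^esub>"
        using \<pi>_one[of "y [^] k"] y by (simp add: \<pi>.hom_nat_pow)
      then show ?thesis using L.pow_eq_id[OF a(1)] a(2) by simp
    qed
    have decomp: "\<exists>q\<in>Q. \<exists>k::nat. z = q \<otimes> y [^] k" if z: "z \<in> carrier N" for z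
    proof -
      have "\<exists>k::nat. \<pi> z = a [^]\<^bsub>L\<^esub> k"
        by (rule L.powers_of_generator[OF L.fin a(1)]) (use a z in \<open>simp_all add: m_def\<close>)
      then obtain k :: nat where "\<pi> z = \<pi> (y [^] k)" using y by (auto simp: \<pi>.hom_nat_pow)
      then have "z \<otimes> inv (y [^] k) \<in> Q" using \<pi>_eq[OF z, of "y [^] k"] y by simp
      moreover have "z = z \<otimes> inv (y [^] k) \<otimes> y [^] k" using z y(1) by (simp add: m_assoc)
      ultimately show ?thesis by blast
    qed
    have "z \<otimes> w = w \<otimes> z" if zw: "z \<in> carrier N" "w \<in> carrier N" for z w
    proof -
      obtain q k where q: "q \<in> Q" and z: "z = q \<otimes> y [^] (k::nat)" using decomp[OF zw(1)] by blast
      obtain r l where r: "r \<in> Q" and w: "w = r \<otimes> y [^] (l::nat)" using decomp[OF zw(2)] by blast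
      have [simp]: "q \<in> carrier N" "r \<in> carrier N" "y \<in> carrier N" using q r y by simp_all
      have "z \<otimes> w = q \<otimes> (r \<otimes> (y [^] k \<otimes> y [^] l))"
        unfolding z w using central[OF _ r, of "y [^] k"] by (simp add: m_assoc) (simp add: m_assoc[symmetric])
      also have "\<dots> = r \<otimes> (q \<otimes> (y [^] l \<otimes> y [^] k))"
        using central[OF _ r, of q] by (simp add: nat_pow_mult add.commute m_assoc[symmetric])
      also have "\<dots> = w \<otimes> z"
        unfolding z w using central[OF _ q, of "y [^] l"] by (simp add: m_assoc) (simp add: m_assoc[symmetric])
      finally show ?thesis .
    qed
    then have "cyclic N"
      using cyclic_if_abelian[OF _ odd_N p(1) m cop Q y(1) y_pow] IH by blast
    with not_cyclic show False ..
  qed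
qed

theorem affine_cycle_imp_cyclic:
  fixes N :: "'a monoid"
  assumes "affine_cycle N \<alpha> c" "odd (order N)"
    and "\<And>p. Factorial_Ring.prime p \<Longrightarrow> p dvd order N \<Longrightarrow> coprime (order N) (p - 1)"
  shows "cyclic N"
  using assms
proof (induction "order N" arbitrary: N \<alpha> c rule: less_induct)
  case less
  show ?case
    by (rule affine_cycle_cyclic_step[OF less.prems less.hyps])
qed

section \<open>Groups of twice odd order\<close>

text \<open>Such a permutation is a product of disjoint transpositions \<open>(a, p a)\<close>; one of them is split off in
  each step.\<close>

lemma sign_fixed_point_free_involution:
  assumes "finite S" and "\<And>x. x \<in> S \<Longrightarrow> p x \<in> S \<and> p x \<noteq> x \<and> p (p x) = x"
    and "\<And>x. x \<notin> S \<Longrightarrow> p x = x"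
  shows "permutation p \<and> sign p = (-1) ^ (card S div 2)"
  using assms
proof (induction "card S" arbitrary: S p rule: less_induct)
  case less
  show ?case
  proof (cases "S = {}")
    case True
    then have "p = id" using less.prems(3) by auto
    then show ?thesis using True by simp
  next
    case False
    then obtain a where a: "a \<in> S" by blast
    define b where "b = p a"
    have b: "b \<in> S" "b \<noteq> a" "p b = a" using less.prems(2)[OF a] by (simp_all add: b_def)
    define q where "q = Transposition.transpose a b \<circ> p"
    define S' where "S' = S - {a, b}"
    have q_other: "q x = p x" if "x \<noteq> a" "x \<noteq> b" for x
    proof -
      have "p x \<noteq> a \<and> p x \<noteq> b"
      proof (cases "x \<in> S")
        case True
        then have "p (p x) = x" using less.prems(2) by blast
        then show ?thesis using that b b_def by metis
      next
        case False
        then show ?thesis using less.prems(3)[OF False] that by simp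
      qed
      then show ?thesis by (simp add: q_def transpose_def)
    qed
    have q_ab: "q a = a" "q b = b" using b by (simp_all add: q_def b_def)
    have card: "card S = card S' + 2"
    proof -
      have "{a, b} \<subseteq> S" "card {a, b} = 2" using a b by auto
      then show ?thesis
        using card_Diff_subset[of "{a, b}" S] card_mono[OF less.prems(1), of "{a, b}"] by (simp add: S'_def)
    qed
    have IH: "permutation q \<and> sign q = (-1) ^ (card S' div 2)"
    proof (rule less.hyps)
      show "card S' < card S" using card by simp
      show "finite S'" using less.prems(1) by (simp add: S'_def)
      show "q x \<in> S' \<and> q x \<noteq> x \<and> q (q x) = x" if "x \<in> S'" for x
      proof -
        have x: "x \<in> S" "x \<noteq> a" "x \<noteq> b" using that by (simp_all add: S'_def)
        have px: "p x \<in> S" "p x \<noteq> x" "p (p x) = x" using less.prems(2)[OF x(1)] by auto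
        then have "p x \<noteq> a" "p x \<noteq> b" using x b b_def by metis+
        then show ?thesis using x px by (simp add: q_other S'_def)
      qed
      show "q x = x" if "x \<notin> S'" for x
        using that q_ab q_other less.prems(3)[of x] by (cases "x = a \<or> x = b") (auto simp: S'_def)
    qed
    have p: "p = Transposition.transpose a b \<circ> q" by (simp add: q_def fun_eq_iff)
    have "permutation p" unfolding p using IH by (intro permutation_compose permutation_swap_id) simp
    moreover have "sign p = sign (Transposition.transpose a b) * sign q"
      unfolding p using IH by (intro sign_compose permutation_swap_id) simp
    ultimately show ?thesis using IH b(2) card by (simp add: sign_swap_id)
  qed
qed

text \<open>The sign of the left translation by \<open>x\<close> is a homomorphism to \<open>{1, -1}\<close>. An involution, which exists
  by Sylow's theorem, translates without fixed points, so it is a product of \<open>n\<close> transpositions and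
  has sign \<open>-1\<close>. The kernel therefore has order \<open>n\<close>, and since \<open>n\<close> is odd, it consists of all
  solutions of \<open>x\<^sup>n = 1\<close>. That description makes it characteristic.\<close>

lemma (in group) odd_part_of_twice_odd:
  assumes ord: "order G = 2 * n" and n: "odd n"
  shows "subgroup {x \<in> carrier G. x [^] n = \<one>} G" "card {x \<in> carrier G. x [^] n = \<one>} = n"
    and "\<exists>t\<in>carrier G. t \<noteq> \<one> \<and> t \<otimes> t = \<one>"
proof -
  have n0: "n > 0" using n by (rule odd_pos)
  have fin: "finite (carrier G)" using ord n0 order_gt_0_iff_finite by simp
  obtain T where T: "subgroup T G" "card T = 2"
    using sylow_thm[of 2 G 1 n] ord fin is_group two_is_prime_nat by auto
  obtain t where t: "t \<in> T" "t \<noteq> \<one>"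
  proof -
    have "T \<noteq> {\<one>}" using T(2) by auto
    then show ?thesis using that subgroup.one_closed[OF T(1)] by blast
  qed
  have tG [simp]: "t \<in> carrier G" by (rule subgroup.mem_carrier[OF T(1) t(1)])
  have tt: "t \<otimes> t = \<one>"
    using pow_eq_one_of_card[OF T(1) t(1)] T(2) by (simp add: numeral_2_eq_2)
  show "\<exists>t\<in>carrier G. t \<noteq> \<one> \<and> t \<otimes> t = \<one>" using t(2) tt by (intro bexI[of _ t]) simp_all
  define L where "L x = (\<lambda>y. if y \<in> carrier G then x \<otimes> y else y)" for x
  have L_mult: "L (x \<otimes> y) = L x \<circ> L y" if "x \<in> carrier G" "y \<in> carrier G" for x y
    using that by (auto simp: L_def fun_eq_iff m_assoc)
  have L_permutation: "permutation (L x)" if x: "x \<in> carrier G" for x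
  proof -
    have "bij_betw (L x) (carrier G) (carrier G)"
      by (rule bij_betwI[where g = "L (inv x)"]) (use x in \<open>auto simp: L_def m_assoc[symmetric]\<close>)
    then have "L x permutes carrier G"
      by (rule bij_imp_permutes) (simp add: L_def)
    then show ?thesis using fin by (auto simp: permutation_permutes)
  qed
  define \<sigma> where "\<sigma> x = sign (L x)" for x
  have \<sigma>_mult: "\<sigma> (x \<otimes> y) = \<sigma> x * \<sigma> y" if "x \<in> carrier G" "y \<in> carrier G" for x y
    unfolding \<sigma>_def L_mult[OF that] by (intro sign_compose L_permutation that)
  have \<sigma>_cases: "\<sigma> x = 1 \<or> \<sigma> x = -1" for x
    unfolding \<sigma>_def by (cases "L x" rule: sign_cases) simp_all
  have "L \<one> = id" by (simp add: L_def fun_eq_iff)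
  then have \<sigma>_one: "\<sigma> \<one> = 1" by (simp add: \<sigma>_def)
  have \<sigma>_t: "\<sigma> t = -1"
  proof -
    have "t \<otimes> y \<noteq> y" if "y \<in> carrier G" for y
      using that t(2) by simp
    then have "permutation (L t) \<and> sign (L t) = (-1) ^ (card (carrier G) div 2)"
      by (intro sign_fixed_point_free_involution fin) (simp_all add: L_def tt m_assoc[symmetric])
    then show ?thesis using ord n by (simp add: \<sigma>_def order_def)
  qed
  define K where "K = {x \<in> carrier G. \<sigma> x = 1}"
  have K: "subgroup K G"
  proof (rule subgroupI)
    show "K \<noteq> {}" using \<sigma>_one by (auto simp: K_def)
    show "inv x \<in> K" if "x \<in> K" for x
      using that \<sigma>_mult[of x "inv x"] \<sigma>_one by (simp add: K_def)
  qed (auto simp: K_def \<sigma>_mult)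
  have "card K = n"
  proof -
    have "bij_betw (\<lambda>x. t \<otimes> x) K (carrier G - K)"
    proof (rule bij_betwI[where g = "\<lambda>x. t \<otimes> x"])
      show "(\<lambda>x. t \<otimes> x) \<in> K \<rightarrow> carrier G - K" by (auto simp: K_def \<sigma>_mult \<sigma>_t)
      show "(\<lambda>x. t \<otimes> x) \<in> carrier G - K \<rightarrow> K" 
      proof
        fix x assume x: "x \<in> carrier G - K"
        then have "\<sigma> x = -1" using \<sigma>_cases[of x] by (simp add: K_def)
        then show "t \<otimes> x \<in> K" using x by (simp add: K_def \<sigma>_mult \<sigma>_t)
      qed
    qed (auto simp: K_def tt m_assoc[symmetric])
    then have "card K = card (carrier G - K)" by (rule bij_betw_same_card)
    moreover have "card (carrier G - K) = card (carrier G) - card K"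
      using finite_subset[OF subgroup.subset[OF K] fin] subgroup.subset[OF K] by (rule card_Diff_subset)
    moreover have "card K \<le> card (carrier G)" by (rule card_mono[OF fin subgroup.subset[OF K]])
    ultimately show ?thesis using ord by (simp add: order_def)
  qed
  have \<sigma>_pow: "\<sigma> (x [^] k) = \<sigma> x ^ k" if "x \<in> carrier G" for x and k :: nat
    by (induction k) (use that in \<open>simp_all add: \<sigma>_mult \<sigma>_one\<close>)
  have "{x \<in> carrier G. x [^] n = \<one>} = K"
  proof (intro equalityI subsetI)
    fix x assume "x \<in> {x \<in> carrier G. x [^] n = \<one>}"
    then have x: "x \<in> carrier G" "x [^] n = \<one>" by auto
    have "\<sigma> x ^ n = 1" using \<sigma>_pow[OF x(1), of n] x(2) \<sigma>_one by simp
    then have "\<sigma> x = 1" using \<sigma>_cases[of x] n by auto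
    then show "x \<in> K" using x by (simp add: K_def)
  next
    fix x assume x: "x \<in> K"
    then show "x \<in> {x \<in> carrier G. x [^] n = \<one>}"
      using pow_eq_one_of_card[OF K x] \<open>card K = n\<close> by (simp add: K_def)
  qed
  then show "subgroup {x \<in> carrier G. x [^] n = \<one>} G" "card {x \<in> carrier G. x [^] n = \<one>} = n"
    using K \<open>card K = n\<close> by simp_all
qed

lemma ord_iso:
  assumes "group G" "group H" "h \<in> iso G H" "x \<in> carrier G"
  shows "group.ord H (h x) = group.ord G x"
proof -
  interpret G: group G by fact
  interpret H: group H by fact
  interpret h: group_hom G H h
    using assms by (simp add: group_hom_def group_hom_axioms_def iso_def)
  have inj: "inj_on h (carrier G)" using assms(3) by (simp add: iso_def bij_betw_def)
  have "h x [^]\<^bsub>H\<^esub> k = \<one>\<^bsub>H\<^esub> \<longleftrightarrow> G.ord x dvd k" for k :: nat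
  proof -
    have "h x [^]\<^bsub>H\<^esub> k = \<one>\<^bsub>H\<^esub> \<longleftrightarrow> h (x [^]\<^bsub>G\<^esub> k) = h \<one>\<^bsub>G\<^esub>"
      using assms(4) by (simp add: h.hom_nat_pow)
    also have "\<dots> \<longleftrightarrow> x [^]\<^bsub>G\<^esub> k = \<one>\<^bsub>G\<^esub>"
      using inj_on_eq_iff[OF inj, of "x [^]\<^bsub>G\<^esub> k" "\<one>\<^bsub>G\<^esub>"] assms(4) by simp
    finally show ?thesis using G.pow_eq_id[OF assms(4)] by simp
  qed
  then show ?thesis using H.ord_unique[of "h x"] assms(4) by simp
qed

lemma iso_exists_ord:
  assumes "group G" "group H" "G \<cong> H" and x: "x \<in> carrier G" "group.ord G x = n"
  shows "\<exists>y\<in>carrier H. group.ord H y = n"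
proof -
  obtain h where h: "h \<in> iso G H" using assms(3) by (auto simp: is_iso_def)
  have "h x \<in> carrier H" using h x(1) by (auto simp: iso_def hom_def)
  then show ?thesis using ord_iso[OF assms(1,2) h x(1)] x(2) by blast
qed

lemma semidirect_of_cyclic_has_element_of_order:
  assumes "n > 0" and \<phi>: "\<phi> \<in> hom (integer_mod_group 2) (AutoGroup (integer_mod_group n))"
  defines "S \<equiv> semidirect (integer_mod_group n) (integer_mod_group 2) \<phi>"
  shows "\<exists>x\<in>carrier S. group.ord S x = n"
proof -
  let ?Z = "integer_mod_group n"
  interpret Z: group ?Z by simp
  interpret Z2: group "integer_mod_group 2" by simp
  interpret S: group S
    unfolding S_def by (intro group_semidirect \<phi>) simp_all
  interpret \<phi>: group_hom "integer_mod_group 2" "AutoGroup ?Z" \<phi>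
    using \<phi> Z.AutoGroup by (simp add: group_hom_def group_hom_axioms_def)
  have \<phi>0: "\<phi> 0 i = i" if "i \<in> carrier ?Z" for i
    using \<phi>.hom_one that by (simp add: AutoGroup_def BijGroup_def)
  define g :: "int \<times> int" where "g = (1 mod int n, 0)"
  have mod_carrier: "i mod int n \<in> carrier ?Z" for i
    using assms(1) by (simp add: carrier_integer_mod_group)
  have g: "g \<in> carrier S"
    using mod_carrier by (simp add: g_def S_def semidirect_def)
  have pow: "g [^]\<^bsub>S\<^esub> k = (int k mod int n, 0)" for k :: nat
  proof (induction k)
    case 0
    then show ?case by (simp add: S_def semidirect_def)
  next
    case (Suc k)
    have "g [^]\<^bsub>S\<^esub> Suc k = (int k mod int n, 0) \<otimes>\<^bsub>S\<^esub> g" using Suc by simp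
    also have "\<dots> = ((int k mod int n + 1 mod int n) mod int n, 0)"
      by (simp add: S_def semidirect_def g_def \<phi>0 mod_carrier)
    finally show ?case by (simp add: mod_add_eq add.commute)
  qed
  have "S.ord g = n"
  proof -
    have "g [^]\<^bsub>S\<^esub> k = \<one>\<^bsub>S\<^esub> \<longleftrightarrow> n dvd k" for k :: nat
    proof -
      have "g [^]\<^bsub>S\<^esub> k = \<one>\<^bsub>S\<^esub> \<longleftrightarrow> int k mod int n = 0"
        unfolding pow by (simp add: S_def semidirect_def)
      then show ?thesis by (simp only: mod_eq_0_iff_dvd int_dvd_int_iff)
    qed
    then show ?thesis using S.ord_unique[OF g] by blast
  qed
  then show ?thesis using g by blast
qed

text \<open>An involution \<open>t\<close> normalises the subgroup generated by \<open>x\<close>, which is the kernel in the preceding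
  lemma, so \<open>t x t = x\<^sup>v\<close> for some \<open>v\<close> with \<open>v\<^sup>2 \<equiv> 1\<close> modulo \<open>n\<close>. The nontrivial element of
  \<open>\<int>\<^sub>2\<close> acts on \<open>\<int>\<^sub>n\<close> as multiplication by \<open>v\<close>.\<close>

lemma (in group) semidirect_of_element_of_order:
  assumes ord: "order G = 2 * n" "odd n" and x: "x \<in> carrier G" "ord x = n"
  shows "\<exists>\<phi> \<in> hom (integer_mod_group 2) (AutoGroup (integer_mod_group n)).
           G \<cong> semidirect (integer_mod_group n) (integer_mod_group 2) \<phi>"
proof -
  let ?Z = "integer_mod_group n"
  interpret Z: group ?Z by simp
  have n0: "n > 0" using ord(2) by (rule odd_pos)
  have fin: "finite (carrier G)" using ord(1) n0 order_gt_0_iff_finite by simp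
  define K where "K = {x \<in> carrier G. x [^] n = \<one>}"
  note K = odd_part_of_twice_odd(1,2)[OF ord, folded K_def]
  obtain t where t: "t \<in> carrier G" "t \<noteq> \<one>" "t \<otimes> t = \<one>"
    using odd_part_of_twice_odd(3)[OF ord] by blast
  note [simp] = x(1) t(1)
  have finK: "finite K" by (rule finite_subset[OF subgroup.subset[OF K(1)] fin])
  have K_pow: "\<exists>k::nat. y = x [^] k" if "y \<in> K" for y
  proof -
    have gen: "generate G {x} = {x [^] k | k. k \<in> (UNIV :: nat set)}"
      by (rule generate_pow_on_finite_carrier[OF fin x(1)])
    have "x \<in> K" using x pow_ord_eq_1[OF x(1)] by (simp add: K_def)
    then have "generate G {x} = K"
      using generate_pow_card[OF x(1)] x(2) K
      by (intro card_subset_eq[OF finK] generate_subgroup_incl) simp_all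
    then have "y \<in> {x [^] k | k. k \<in> (UNIV :: nat set)}" using gen that by simp
    then show ?thesis by simp
  qed
  have conj_pow: "(t \<otimes> y \<otimes> t) [^] k = t \<otimes> y [^] k \<otimes> t" if "y \<in> carrier G" for y and k :: nat
  proof (induction k)
    case (Suc k)
    have "(t \<otimes> y [^] k \<otimes> t) \<otimes> (t \<otimes> y \<otimes> t) = t \<otimes> y [^] k \<otimes> (t \<otimes> t) \<otimes> y \<otimes> t"
      using that by (simp only: m_assoc m_closed t(1) nat_pow_closed)
    then show ?case using that Suc t(3) by (simp add: m_assoc)
  qed (simp add: t(3))
  have "(t \<otimes> x \<otimes> t) [^] n = \<one>"
    using pow_ord_eq_1[OF x(1)] x(2) t(3) by (simp add: conj_pow)
  then have "t \<otimes> x \<otimes> t \<in> K" by (simp add: K_def)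
  then obtain v :: nat where v: "t \<otimes> x \<otimes> t = x [^] v" using K_pow by blast
  have tx: "t \<otimes> x [^] k = x [^] (v * k) \<otimes> t" for k :: nat
  proof -
    have "x [^] (v * k) = t \<otimes> x [^] k \<otimes> t" using conj_pow[of x k] v by (simp add: nat_pow_pow)
    then show ?thesis using t(3) by (simp add: m_assoc)
  qed
  have "x [^] (v * v) = x [^] (1::nat)"
  proof -
    have "x [^] (v * v) = t \<otimes> (t \<otimes> x \<otimes> t) \<otimes> t" using conj_pow[of x v] v by (simp add: nat_pow_pow)
    also have "\<dots> = (t \<otimes> t) \<otimes> x \<otimes> (t \<otimes> t)" by (simp only: m_assoc m_closed x(1) t(1))
    finally show ?thesis using t(3) by simp
  qed
  then have "[v * v = 1] (mod n)" using nat_pow_eq_iff_cong[OF x(1)] x(2) by blast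
  then have vv: "[int v * int v = 1] (mod int n)" using cong_int_iff[of "v * v" 1 n] by simp
  have Z_carrier: "carrier ?Z = {0..<int n}" using n0 by (simp add: carrier_integer_mod_group)
  define f where "f = (\<lambda>i\<in>carrier ?Z. (int v * i) mod int n)"
  have f_closed: "f i \<in> carrier ?Z" if "i \<in> carrier ?Z" for i
    using that n0 by (simp add: f_def Z_carrier)
  have ff: "f (f i) = i" if i: "i \<in> carrier ?Z" for i
  proof -
    have "f (f i) = (int v * int v * i) mod int n"
      using i f_closed[OF i] by (simp add: f_def mod_mult_right_eq mult.assoc)
    also have "\<dots> = (1 * i) mod int n"
      using cong_scalar_right[OF vv, of i] by (simp only: cong_def)
    also have "\<dots> = i" using i by (simp add: Z_carrier)
    finally show ?thesis .
  qed
  have f_auto: "f \<in> auto ?Z"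
  proof -
    have "f \<in> hom ?Z ?Z"
    proof (rule homI)
      fix i j assume ij: "i \<in> carrier ?Z" "j \<in> carrier ?Z"
      then have "i \<otimes>\<^bsub>?Z\<^esub> j \<in> carrier ?Z" by (rule Z.m_closed)
      then show "f (i \<otimes>\<^bsub>?Z\<^esub> j) = f i \<otimes>\<^bsub>?Z\<^esub> f j"
        using ij by (simp add: f_def mod_simps distrib_left)
    qed (rule f_closed)
    moreover have "bij_betw f (carrier ?Z) (carrier ?Z)"
      by (rule bij_betwI[where g = f]) (auto simp: f_closed ff)
    ultimately show ?thesis by (simp add: auto_def Bij_def f_def)
  qed
  have f_Bij: "f \<in> Bij (carrier ?Z)" using f_auto by (simp add: auto_def)
  define \<phi> :: "int \<Rightarrow> int \<Rightarrow> int" where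
    "\<phi> b = (if b = 0 then (\<lambda>i\<in>carrier ?Z. i) else f)" for b
  have \<phi>: "\<phi> \<in> hom (integer_mod_group 2) (AutoGroup ?Z)"
  proof (rule homI)
    show "\<phi> b \<in> carrier (AutoGroup ?Z)" for b
      using f_auto Z.id_in_auto by (simp add: \<phi>_def AutoGroup_def)
    fix b b' assume "b \<in> carrier (integer_mod_group 2)" "b' \<in> carrier (integer_mod_group 2)"
    then have "b = 0 \<or> b = 1" "b' = 0 \<or> b' = 1" by (auto simp: carrier_integer_mod_group)
    moreover have "compose (carrier ?Z) f f = (\<lambda>i\<in>carrier ?Z. i)"
      by (auto simp: compose_def ff)
    ultimately show "\<phi> (b \<otimes>\<^bsub>integer_mod_group 2\<^esub> b') = \<phi> b \<otimes>\<^bsub>AutoGroup ?Z\<^esub> \<phi> b'"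
      using f_Bij Bij_imp_extensional[OF f_Bij] Bij_imp_funcset[OF f_Bij] id_Bij
      by (auto simp: \<phi>_def AutoGroup_def BijGroup_def)
  qed
  define S where "S = semidirect ?Z (integer_mod_group 2) \<phi>"
  interpret S: group S
    unfolding S_def by (intro group_semidirect \<phi>) simp_all
  have S_carrier: "carrier S = {0..<int n} \<times> {0..<2}"
    by (simp add: S_def semidirect_def Z_carrier) (simp add: carrier_integer_mod_group)
  define \<Psi> where "\<Psi> = (\<lambda>(i, b). x [^] nat i \<otimes> t [^] nat b)"
  have xmod: "x [^] nat (i mod int n) = x [^] nat i" if "i \<ge> 0" for i
  proof -
    have "nat (i mod int n) = nat i mod n" using that by (simp add: nat_mod_distrib)
    then show ?thesis using nat_pow_eq_iff_cong[OF x(1)] x(2) by (simp add: cong_def)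
  qed
  have "\<Psi> \<in> hom S G"
  proof (rule homI)
    show "\<Psi> p \<in> carrier G" for p by (simp add: \<Psi>_def split: prod.split)
    fix p q assume pq: "p \<in> carrier S" "q \<in> carrier S"
    obtain i b j b' where p: "p = (i, b)" and q: "q = (j, b')" by (cases p, cases q)
    have i: "i \<ge> 0" "j \<ge> 0" "j \<in> carrier ?Z" and b: "b = 0 \<or> b = 1" "b' = 0 \<or> b' = 1"
      using pq by (auto simp: p q S_carrier Z_carrier)
    have mult: "p \<otimes>\<^bsub>S\<^esub> q = ((i + \<phi> b j) mod int n, (b + b') mod 2)"
      by (simp add: p q S_def semidirect_def)
    define w where "w = (if b = 0 then 1 else v)"
    have "[\<phi> b j = int w * j] (mod int n)"
      using i b by (auto simp: \<phi>_def f_def w_def cong_def)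
    then have "[i + \<phi> b j = i + int w * j] (mod int n)"
      by (rule cong_add[OF cong_refl])
    then have "(i + \<phi> b j) mod int n = (i + int w * j) mod int n"
      by (simp only: cong_def)
    then have 1: "x [^] nat ((i + \<phi> b j) mod int n) = x [^] nat i \<otimes> x [^] (w * nat j)"
    proof -
      have "nat (i + int w * j) = nat i + w * nat j" using i by (simp add: nat_add_distrib nat_mult_distrib)
      moreover have "x [^] nat ((i + \<phi> b j) mod int n) = x [^] nat (i + int w * j)"
        using xmod[of "i + int w * j"] i \<open>(i + \<phi> b j) mod int n = _\<close> by simp
      ultimately show ?thesis by (simp only: nat_pow_mult[OF x(1)])
    qed
    have 2: "t [^] nat b \<otimes> x [^] nat j = x [^] (w * nat j) \<otimes> t [^] nat b"
      using b tx[of "nat j"] by (auto simp: w_def)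
    have 3: "t [^] nat ((b + b') mod 2) = t [^] nat b \<otimes> t [^] nat b'"
      using b t(3) by auto
    have "\<Psi> p \<otimes> \<Psi> q = x [^] nat i \<otimes> (t [^] nat b \<otimes> x [^] nat j) \<otimes> t [^] nat b'"
      by (simp add: \<Psi>_def p q m_assoc)
    also have "\<dots> = \<Psi> (p \<otimes>\<^bsub>S\<^esub> q)"
      unfolding mult 2 by (simp add: \<Psi>_def 1 3 m_assoc)
    finally show "\<Psi> (p \<otimes>\<^bsub>S\<^esub> q) = \<Psi> p \<otimes> \<Psi> q" by simp
  qed
  then interpret \<Psi>: group_hom S G \<Psi>
    by (simp add: group_hom_def group_hom_axioms_def is_group S.is_group)
  have "inj_on \<Psi> (carrier S)"
    unfolding \<Psi>.inj_on_one_iff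
  proof (intro allI ballI impI)
    fix p assume p: "p \<in> carrier S" "\<Psi> p = \<one>"
    obtain i b where ib: "p = (i, b)" by (cases p)
    have i: "0 \<le> i" "i < int n" and b: "b = 0 \<or> b = 1" using p(1) by (auto simp: ib S_carrier)
    have eq: "x [^] nat i \<otimes> t [^] nat b = \<one>" using p(2) by (simp add: \<Psi>_def ib)
    have "b = 0"
    proof (rule ccontr)
      assume "b \<noteq> 0"
      then have "x [^] nat i \<otimes> t = \<one>" using eq b by simp
      then have "t = inv (x [^] nat i)" using inv_equality[of t "x [^] nat i"] inv_comm by simp
      moreover have "(x [^] nat i) [^] n = \<one>"
        using pow_eq_id[OF x(1)] x(2) by (simp add: nat_pow_pow)
      ultimately have "t [^] n = \<one>" by (simp add: nat_pow_inv)
      moreover have "t [^] n = t"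
      proof -
        obtain k where "n = Suc (2 * k)" using ord(2) by (metis oddE Suc_eq_plus1)
        moreover have "t [^] (2 * k) = (t [^] (2::nat)) [^] k" by (simp add: nat_pow_pow)
        ultimately show ?thesis using t(3) by (simp add: numeral_2_eq_2)
      qed
      ultimately show False using t(2) by simp
    qed
    then have "x [^] nat i = \<one>" using eq by simp
    then have "n dvd nat i" using pow_eq_id[OF x(1)] x(2) by simp
    then have "i = 0" using i by (auto dest: dvd_imp_le)
    with \<open>b = 0\<close> show "p = \<one>\<^bsub>S\<^esub>" by (simp add: ib S_def semidirect_def)
  qed
  moreover have "card (carrier S) = card (carrier G)" using ord(1) by (simp add: S_carrier order_def)
  moreover have "\<Psi> ` carrier S \<subseteq> carrier G" by auto
  ultimately have "\<Psi> ` carrier S = carrier G"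
    by (intro card_subset_eq[OF fin]) (simp_all add: card_image)
  then have "\<Psi> \<in> iso S G"
    using \<open>inj_on \<Psi> (carrier S)\<close> \<Psi>.homh by (simp add: iso_def bij_betw_def)
  then have "G \<cong> S" using S.iso_sym[of G] by (auto simp: is_iso_def)
  then show ?thesis using \<phi> by (auto simp: S_def)
qed

lemma semidirect_iff_element_of_order:
  fixes G :: "('a, 'c) monoid_scheme"
  assumes "group G" "order G = 2 * n" "odd n"
  shows "(\<exists>\<phi> \<in> hom (integer_mod_group 2) (AutoGroup (integer_mod_group n)).
           G \<cong> semidirect (integer_mod_group n) (integer_mod_group 2) \<phi>)
     \<longleftrightarrow> (\<exists>x\<in>carrier G. group.ord G x = n)"
proof
  assume "\<exists>\<phi> \<in> hom (integer_mod_group 2) (AutoGroup (integer_mod_group n)).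
           G \<cong> semidirect (integer_mod_group n) (integer_mod_group 2) \<phi>"
  then obtain \<phi> where \<phi>: "\<phi> \<in> hom (integer_mod_group 2) (AutoGroup (integer_mod_group n))"
    and iso: "G \<cong> semidirect (integer_mod_group n) (integer_mod_group 2) \<phi>" by blast
  have S: "group (semidirect (integer_mod_group n) (integer_mod_group 2) \<phi>)"
    by (intro group_semidirect \<phi>) simp_all
  obtain y where "y \<in> carrier (semidirect (integer_mod_group n) (integer_mod_group 2) \<phi>)"
    "group.ord (semidirect (integer_mod_group n) (integer_mod_group 2) \<phi>) y = n"
    using semidirect_of_cyclic_has_element_of_order[OF odd_pos[OF assms(3)] \<phi>] by blast
  then show "\<exists>x\<in>carrier G. group.ord G x = n"
    by (rule iso_exists_ord[OF S assms(1) group.iso_sym[OF assms(1) iso]])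
next
  assume "\<exists>x\<in>carrier G. group.ord G x = n"
  then show "\<exists>\<phi> \<in> hom (integer_mod_group 2) (AutoGroup (integer_mod_group n)).
           G \<cong> semidirect (integer_mod_group n) (integer_mod_group 2) \<phi>"
    using group.semidirect_of_element_of_order[OF assms] by blast
qed

section \<open>Regular subgroups of the holomorph\<close>

lemma coprime_of_burnside_rad:
  assumes n: "n > 0" "burnside_number (rad n)" and p: "Factorial_Ring.prime p" "p dvd n"
  shows "coprime n (p - 1)"
proof -
  have dvd_rad: "q dvd rad n" if "Factorial_Ring.prime q" "q dvd n" for q :: nat
  proof -
    have "q \<in> prime_factors n" using that n(1) by (simp add: prime_factors_dvd)
    then have "id q dvd (\<Prod>q\<in>prime_factors n. id q)" by (intro dvd_prodI) simp_all
    then show ?thesis by (simp add: rad_def)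
  qed
  have "p - 1 dvd totient (rad n)"
    using totient_dvd[OF dvd_rad[OF p]] totient_prime[OF p(1)] by simp
  then have cop: "coprime (rad n) (p - 1)"
    using n(2) coprime_divisors[OF dvd_refl] by (auto simp: burnside_number_def)
  show ?thesis
  proof (rule ccontr)
    assume "\<not> coprime n (p - 1)"
    then obtain q where q: "Factorial_Ring.prime q" "q dvd n" "q dvd p - 1"
      using prime_factor_nat[of "gcd n (p - 1)"] by (auto simp: coprime_iff_gcd_eq_1)
    then have "q dvd 1" using cop dvd_rad[OF q(1,2)] by (metis coprime_common_divisor)
    then show False using q(1) by simp
  qed
qed

text \<open>The equality of orders turns the transitivity of \<open>H\<close> into a bijection between \<open>H\<close> and \<open>N\<close>, which
  sends an element of the holomorph to its translation part.\<close>

locale regular_in_holomorph = group N for N (structure) +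
  fixes H :: "('a \<times> ('a \<Rightarrow> 'a)) set" and n :: nat
  assumes regular: "regular_subgroup N H" and card_H: "card H = order N"
    and order_N: "order N = 2 * n" and odd_n: "odd n"
    and coprime_n: "\<And>p. Factorial_Ring.prime p \<Longrightarrow> p dvd n \<Longrightarrow> coprime n (p - 1)"
begin

abbreviation R where "R \<equiv> holomorph N\<lparr>carrier := H\<rparr>"

definition N1 where "N1 = {x \<in> carrier N. x [^] n = \<one>}"

lemma n_pos: "n > 0" using odd_n by (rule odd_pos)

lemma fin: "finite (carrier N)"
  using order_N n_pos order_gt_0_iff_finite by simp

lemma fin_H: "finite H"
  using card_H order_N n_pos by (intro card_ge_0_finite) simp

lemma H_subgroup: "subgroup H (holomorph N)"
  using regular by (simp add: regular_subgroup_def)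

lemma group_R: "group R"
  by (rule group.subgroup_imp_group[OF group_holomorph[OF is_group] H_subgroup])

sublocale R: group R by (rule group_R)

lemma H_auto:
  assumes "(x, \<beta>) \<in> H"
  shows "x \<in> carrier N" "\<beta> \<in> auto N"
  using subgroup.mem_carrier[OF H_subgroup assms]
  by (simp_all add: holomorph_def semidirect_def AutoGroup_def)

lemma auto_hom:
  assumes "\<beta> \<in> auto N"
  shows "\<beta> \<in> hom N N" "inj_on \<beta> (carrier N)"
  using assms by (simp_all add: auto_def Bij_def bij_betw_def)

lemma R_mult:
  assumes "(x, \<beta>) \<in> H" "(y, \<gamma>) \<in> H"
  shows "(x, \<beta>) \<otimes>\<^bsub>R\<^esub> (y, \<gamma>) = (x \<otimes> \<beta> y, compose (carrier N) \<beta> \<gamma>)"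
  using H_auto(2)[OF assms(1)] H_auto(2)[OF assms(2)]
  by (simp add: holomorph_def semidirect_def AutoGroup_def BijGroup_def auto_def)

lemma R_one: "\<one>\<^bsub>R\<^esub> = (\<one>, \<lambda>x\<in>carrier N. x)"
  by (simp add: holomorph_def semidirect_def AutoGroup_def BijGroup_def)

lemma H_surj:
  assumes y: "y \<in> carrier N"
  shows "\<exists>\<beta>. (y, \<beta>) \<in> H"
proof -
  interpret transitive_action R "carrier N" "hol_action N"
    using regular by (simp add: regular_subgroup_def)
  obtain h where h: "h \<in> H" "hol_action N h \<one> = y"
    using unique_orbit[OF one_closed y] by auto
  obtain x \<beta> where xb: "h = (x, \<beta>)" by (cases h)
  note \<beta> = auto_hom(1)[OF H_auto(2)[OF h(1)[unfolded xb]]]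
  have "y = x"
    using h(2) H_auto(1)[OF h(1)[unfolded xb]] hom_one[OF \<beta> is_group is_group]
    by (simp add: xb hol_action_def)
  then show ?thesis using h(1) xb by blast
qed

lemma fst_image: "fst ` H = carrier N"
proof
  show "fst ` H \<subseteq> carrier N" using H_auto(1) by auto
  show "carrier N \<subseteq> fst ` H" using H_surj by force
qed

lemma fst_inj: "inj_on fst H"
  by (rule eq_card_imp_inj_on[OF fin_H]) (simp add: fst_image card_H order_def)

lemma N1_subgroup: "subgroup N1 N" and card_N1: "card N1 = n"
  using odd_part_of_twice_odd(1,2)[OF order_N odd_n] by (simp_all add: N1_def)

lemma auto_N1:
  assumes \<beta>: "\<beta> \<in> auto N" and x: "x \<in> carrier N"
  shows "\<beta> x \<in> N1 \<longleftrightarrow> x \<in> N1"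
proof -
  interpret \<beta>: group_hom N N \<beta>
    using auto_hom(1)[OF \<beta>] by (simp add: group_hom_def group_hom_axioms_def is_group)
  have "\<beta> x [^] n = \<one> \<longleftrightarrow> \<beta> (x [^] n) = \<beta> \<one>" using x by (simp add: \<beta>.hom_nat_pow)
  also have "\<dots> \<longleftrightarrow> x [^] n = \<one>"
    using inj_on_eq_iff[OF auto_hom(2)[OF \<beta>], of "x [^] n" \<one>] x by simp
  finally show ?thesis using x by (simp add: N1_def)
qed

definition H1 where "H1 = {h \<in> H. fst h \<in> N1}"

lemma card_H1: "card H1 = n"
proof -
  have "fst ` H1 = N1"
    using fst_image subgroup.subset[OF N1_subgroup] by (force simp: H1_def)
  then show ?thesis
    using card_image[OF inj_on_subset[OF fst_inj, of H1]] card_N1 by (auto simp: H1_def)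
qed

lemma H1_subgroup: "subgroup H1 R"
proof (rule R.subgroupI)
  interpret N1: subgroup N1 N by (rule N1_subgroup)
  show "H1 \<subseteq> carrier R" by (auto simp: H1_def)
  show "H1 \<noteq> {}" using card_H1 n_pos by auto
  fix h assume h: "h \<in> H1"
  obtain x \<beta> where xb: "h = (x, \<beta>)" by (cases h)
  have hH: "(x, \<beta>) \<in> H" and x: "x \<in> N1" using h by (simp_all add: H1_def xb)
  {
    have inv_H: "inv\<^bsub>R\<^esub> h \<in> H" using R.inv_closed[of h] hH by (simp add: xb)
    obtain y \<gamma> where yc: "inv\<^bsub>R\<^esub> h = (y, \<gamma>)" by (cases "inv\<^bsub>R\<^esub> h")
    have "h \<otimes>\<^bsub>R\<^esub> inv\<^bsub>R\<^esub> h = \<one>\<^bsub>R\<^esub>" using R.r_inv[of h] hH by (simp add: xb)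
    then have "x \<otimes> \<beta> y = \<one>"
      using R_mult[OF hH, of y \<gamma>] inv_H unfolding yc R_one by (simp add: xb)
    moreover have y: "y \<in> carrier N" using H_auto(1) inv_H yc by simp
    moreover have "\<beta> y \<in> carrier N"
      using auto_hom(1)[OF H_auto(2)[OF hH]] y by (auto simp: hom_def)
    ultimately have "\<beta> y = inv x"
      using x N1.mem_carrier by (metis inv_equality inv_comm)
    then have "\<beta> y \<in> N1" using x by simp
    then show "inv\<^bsub>R\<^esub> h \<in> H1"
      using auto_N1[OF H_auto(2)[OF hH] y] inv_H yc by (simp add: H1_def)
  }
  fix k assume k: "k \<in> H1"
  obtain y \<gamma> where yc: "k = (y, \<gamma>)" by (cases k)
  have kH: "(y, \<gamma>) \<in> H" and y: "y \<in> N1" using k by (simp_all add: H1_def yc)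
  have "h \<otimes>\<^bsub>R\<^esub> k \<in> H" using R.m_closed[of h k] hH kH by (simp add: xb yc)
  moreover have "\<beta> y \<in> N1" using auto_N1[OF H_auto(2)[OF hH] N1.mem_carrier[OF y]] y by simp
  ultimately show "h \<otimes>\<^bsub>R\<^esub> k \<in> H1"
    using R_mult[OF hH kH] x by (simp add: H1_def xb yc)
qed

lemma order_R: "order R = 2 * n"
  using card_H order_N by (simp add: order_def)

text \<open>Both sides describe the subgroup of order \<open>n\<close> in a group of order \<open>2 n\<close>. This is what links the
  elements of order \<open>n\<close> in \<open>H\<close> to those in \<open>N\<close>.\<close>

lemma pow_n_iff:
  assumes "h \<in> H"
  shows "h [^]\<^bsub>R\<^esub> n = \<one>\<^bsub>R\<^esub> \<longleftrightarrow> fst h \<in> N1"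
proof -
  have "H1 = {h \<in> carrier R. h [^]\<^bsub>R\<^esub> n = \<one>\<^bsub>R\<^esub>}"
  proof (rule card_subset_eq)
    show "finite {h \<in> carrier R. h [^]\<^bsub>R\<^esub> n = \<one>\<^bsub>R\<^esub>}" using fin_H by simp
    show "H1 \<subseteq> {h \<in> carrier R. h [^]\<^bsub>R\<^esub> n = \<one>\<^bsub>R\<^esub>}"
      using R.pow_eq_one_of_card[OF H1_subgroup] card_H1 by (auto simp: H1_def)
    show "card H1 = card {h \<in> carrier R. h [^]\<^bsub>R\<^esub> n = \<one>\<^bsub>R\<^esub>}"
      unfolding card_H1 by (rule R.odd_part_of_twice_odd(2)[OF order_R odd_n, symmetric])
  qed
  then have "h \<in> H1 \<longleftrightarrow> h [^]\<^bsub>R\<^esub> n = \<one>\<^bsub>R\<^esub>" using assms by simp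
  then show ?thesis using assms by (simp add: H1_def)
qed

lemma R_pow:
  assumes h: "(c, \<alpha>) \<in> H"
  shows "fst ((c, \<alpha>) [^]\<^bsub>R\<^esub> k) = ((\<lambda>y. c \<otimes> \<alpha> y) ^^ k) \<one>"
    and "x \<in> carrier N \<Longrightarrow> snd ((c, \<alpha>) [^]\<^bsub>R\<^esub> k) x = (\<alpha> ^^ k) x"
proof -
  have "fst ((c, \<alpha>) [^]\<^bsub>R\<^esub> k) = ((\<lambda>y. c \<otimes> \<alpha> y) ^^ k) \<one> \<and>
    (\<forall>x\<in>carrier N. snd ((c, \<alpha>) [^]\<^bsub>R\<^esub> k) x = (\<alpha> ^^ k) x)"
  proof (induction k)
    case 0
    then show ?case by (simp add: R_one del: monoid.simps)
  next
    case (Suc k)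
    obtain y \<gamma> where yc: "(c, \<alpha>) [^]\<^bsub>R\<^esub> k = (y, \<gamma>)" by (cases "(c, \<alpha>) [^]\<^bsub>R\<^esub> k")
    have yH: "(y, \<gamma>) \<in> H" using R.nat_pow_closed[of "(c, \<alpha>)" k] h yc by simp
    have "(c, \<alpha>) [^]\<^bsub>R\<^esub> Suc k = (c, \<alpha>) \<otimes>\<^bsub>R\<^esub> (c, \<alpha>) [^]\<^bsub>R\<^esub> k"
      by (rule R.nat_pow_Suc2) (use h in simp)
    also have "\<dots> = (c \<otimes> \<alpha> y, compose (carrier N) \<alpha> \<gamma>)"
      unfolding yc by (rule R_mult[OF h yH])
    finally show ?case using Suc yc by (simp add: compose_def)
  qed
  then show "fst ((c, \<alpha>) [^]\<^bsub>R\<^esub> k) = ((\<lambda>y. c \<otimes> \<alpha> y) ^^ k) \<one>"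
    and "x \<in> carrier N \<Longrightarrow> snd ((c, \<alpha>) [^]\<^bsub>R\<^esub> k) x = (\<alpha> ^^ k) x" by blast+
qed

text \<open>Transitivity gives an element \<open>h = (m, \<beta>)\<close> of \<open>H\<close>, and \<open>\<beta> m = m\<^sup>u\<close> for some \<open>u\<close>. From \<open>h\<^sup>n = 1\<close>
  it follows that \<open>u\<^sup>n \<equiv> 1\<close> modulo \<open>n\<close>, and then \<open>u \<equiv> 1\<close> modulo every prime divisor of \<open>n\<close> by the
  Burnside condition. As \<open>h\<^sup>k\<close> sends the identity to the power of \<open>m\<close> with exponent \<open>geo u k\<close>, the
  order of \<open>h\<close> is a multiple of \<open>n\<close>.\<close>

lemma order_n_element_of_H:
  assumes m: "m \<in> carrier N" "ord m = n"
  shows "\<exists>h\<in>H. R.ord h = n"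
proof -
  have mN1: "m \<in> N1" using m pow_ord_eq_1[OF m(1)] by (simp add: N1_def)
  obtain \<beta> where h: "(m, \<beta>) \<in> H" using H_surj[OF m(1)] by blast
  have hR: "(m, \<beta>) \<in> carrier R" using h by simp
  note \<beta>_auto = H_auto(2)[OF h]
  interpret \<beta>: group_hom N N \<beta>
    using auto_hom(1)[OF \<beta>_auto] by (simp add: group_hom_def group_hom_axioms_def is_group)
  have h_pow: "(m, \<beta>) [^]\<^bsub>R\<^esub> n = \<one>\<^bsub>R\<^esub>" using pow_n_iff[OF h] mN1 by simp
  interpret C: subgroup N1 N by (rule N1_subgroup)
  obtain u :: nat where u: "\<beta> m = m [^] u"
  proof -
    have gen: "generate N {m} = {m [^] k | k. k \<in> (UNIV :: nat set)}"
      by (rule generate_pow_on_finite_carrier[OF fin m(1)])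
    have "generate N {m} = N1"
      using generate_pow_card[OF m(1)] m(2) mN1 card_N1
      by (intro card_subset_eq[OF finite_subset[OF C.subset fin]] generate_subgroup_incl N1_subgroup) simp_all
    moreover have "\<beta> m \<in> N1" using auto_N1[OF \<beta>_auto m(1)] mN1 by simp
    ultimately have "\<beta> m \<in> {m [^] k | k. k \<in> (UNIV :: nat set)}" using gen by simp
    then show ?thesis using that by auto
  qed
  have iter: "(\<beta> ^^ k) m = m [^] (u ^ k)" for k
  proof (induction k)
    case (Suc k)
    then have "(\<beta> ^^ Suc k) m = (m [^] u) [^] (u ^ k)" using m(1) by (simp add: \<beta>.hom_nat_pow u)
    then show ?case using m(1) by (simp add: nat_pow_pow)
  qed (use m(1) in simp)
  have "(\<beta> ^^ n) m = m"
    using R_pow(2)[OF h m(1), of n] m(1) unfolding h_pow R_one by simp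
  then have "m [^] (u ^ n) = m [^] (1::nat)" using iter[of n] m(1) by simp
  then have un: "[u ^ n = 1] (mod n)" using nat_pow_eq_iff_cong[OF m(1)] m(2) by blast
  have u1: "[u = 1] (mod p)" if p: "Factorial_Ring.prime p" "p dvd n" for p
    by (rule pow_cong_1_coprime[OF p(1) cong_dvd_modulus_nat[OF un p(2)] coprime_n[OF p] n_pos])
  have fst_pow: "fst ((m, \<beta>) [^]\<^bsub>R\<^esub> k) = m [^] geo u k" for k
  proof -
    have "((\<lambda>y. m \<otimes> \<beta> y) ^^ k) \<one> = m [^] geo u k"
    proof (induction k)
      case (Suc k)
      have "geo u (Suc k) = 1 + u * geo u k" using geo_add[of u 1 k] by (simp add: geo_def)
      then have "m [^] geo u (Suc k) = m \<otimes> m [^] (u * geo u k)"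
        using nat_pow_mult[OF m(1), of 1 "u * geo u k"] m(1) by simp
      then show ?case using Suc m(1) by (simp add: \<beta>.hom_nat_pow u nat_pow_pow)
    qed (simp add: geo_def)
    then show ?thesis using R_pow(1)[OF h] by simp
  qed
  have "n dvd k" if "(m, \<beta>) [^]\<^bsub>R\<^esub> k = \<one>\<^bsub>R\<^esub>" for k :: nat
  proof -
    have "m [^] geo u k = \<one>" using fst_pow[of k] unfolding that R_one by simp
    then have "n dvd geo u k" using pow_eq_id[OF m(1)] m(2) by simp
    then show ?thesis using dvd_geoD[OF odd_n u1] by blast
  qed
  then have "n dvd R.ord (m, \<beta>)" using R.pow_ord_eq_1[OF hR] by blast
  moreover have "R.ord (m, \<beta>) dvd n" using R.pow_eq_id[OF hR] h_pow by blast
  ultimately have "R.ord (m, \<beta>) = n" by (intro dvd_antisym)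
  then show ?thesis using h by blast
qed

text \<open>The powers of \<open>h = (c, \<alpha>)\<close> are the elements of \<open>H\<close> with translation part in \<open>N1\<close>. By transitivity
  those translation parts exhaust \<open>N1\<close>, so \<open>c\<close> and \<open>\<alpha>\<close> form an affine cycle on \<open>N1\<close>.\<close>

lemma order_n_element_of_N:
  assumes h: "h \<in> H" "R.ord h = n"
  shows "\<exists>x\<in>carrier N. ord x = n"
proof -
  obtain c \<alpha> where ca: "h = (c, \<alpha>)" by (cases h)
  have cH: "(c, \<alpha>) \<in> H" using h(1) ca by simp
  have hR: "h \<in> carrier R" using h(1) by simp
  interpret N1: subgroup N1 N by (rule N1_subgroup)
  have "h [^]\<^bsub>R\<^esub> n = \<one>\<^bsub>R\<^esub>" using R.pow_ord_eq_1[OF hR] h(2) by simp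
  then have cN1: "c \<in> N1" and hH1: "h \<in> H1" using pow_n_iff[OF h(1)] h(1) ca by (simp_all add: H1_def)
  note \<alpha>_auto = H_auto(2)[OF cH]
  have finH1: "finite H1" by (rule finite_subset[OF _ fin_H]) (auto simp: H1_def)
  have H1_pow: "\<exists>k::nat. g = h [^]\<^bsub>R\<^esub> k" if "g \<in> H1" for g
  proof -
    have gen: "generate R {h} = {h [^]\<^bsub>R\<^esub> k | k. k \<in> (UNIV :: nat set)}"
      by (rule R.generate_pow_on_finite_carrier[OF _ hR]) (use fin_H in simp)
    have "generate R {h} = H1"
      using R.generate_pow_card[OF hR] h(2) hH1 card_H1
      by (intro card_subset_eq[OF finH1] R.generate_subgroup_incl H1_subgroup) simp_all
    then have "g \<in> {h [^]\<^bsub>R\<^esub> k | k. k \<in> (UNIV :: nat set)}" using gen that by simp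
    then show ?thesis by simp
  qed
  \<comment> \<open>A copy of \<open>N1\<close> without further record fields, as the theorem on affine cycles requires.\<close>
  define L :: "'a monoid" where "L = \<lparr>carrier = N1, monoid.mult = (\<otimes>), one = \<one>\<rparr>"
  have L_pow: "x [^]\<^bsub>L\<^esub> k = x [^] k" for x and k :: nat
    unfolding nat_pow_def L_def by simp
  have group_L: "group L"
  proof (rule groupI)
    fix x assume "x \<in> carrier L"
    then have "x \<in> N1" by (simp add: L_def)
    then show "\<exists>y\<in>carrier L. y \<otimes>\<^bsub>L\<^esub> x = \<one>\<^bsub>L\<^esub>"
      by (intro bexI[of _ "inv x"]) (simp_all add: L_def)
  qed (simp_all add: L_def m_assoc)
  interpret L: group L by (rule group_L)
  have "affine_cycle L \<alpha> c"
  proof (intro affine_cycle.intro group_L affine_cycle_axioms.intro)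
    show "finite (carrier L)" using finite_subset[OF N1.subset fin] by (simp add: L_def)
    show "\<alpha> \<in> hom L L"
      using auto_hom(1)[OF \<alpha>_auto] auto_N1[OF \<alpha>_auto]
      by (intro homI) (auto simp: L_def hom_def)
    show "inj_on \<alpha> (carrier L)"
      using inj_on_subset[OF auto_hom(2)[OF \<alpha>_auto] N1.subset] by (simp add: L_def)
    show "c \<in> carrier L" using cN1 by (simp add: L_def)
    fix y assume "y \<in> carrier L"
    then have y: "y \<in> N1" by (simp add: L_def)
    obtain \<beta> where "(y, \<beta>) \<in> H" using H_surj[OF N1.mem_carrier[OF y]] by blast
    then have "(y, \<beta>) \<in> H1" using y by (simp add: H1_def)
    then obtain k :: nat where k: "(y, \<beta>) = h [^]\<^bsub>R\<^esub> k" using H1_pow by blast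
    have "fst (h [^]\<^bsub>R\<^esub> k) = y" by (simp flip: k)
    then show "\<exists>k. ((\<lambda>z. c \<otimes>\<^bsub>L\<^esub> \<alpha> z) ^^ k) \<one>\<^bsub>L\<^esub> = y"
      using R_pow(1)[OF cH, of k] by (intro exI[of _ k]) (simp add: L_def ca)
  qed
  moreover have order_L: "order L = n" by (simp add: order_def L_def card_N1)
  ultimately have "cyclic L"
    using affine_cycle_imp_cyclic[of L \<alpha> c] odd_n coprime_n by simp
  then obtain x where x: "x \<in> carrier L" "L.ord x = n" using order_L by (auto simp: cyclic_def)
  then have xN: "x \<in> carrier N" by (simp add: L_def)
  have "x [^] k = \<one> \<longleftrightarrow> n dvd k" for k :: nat
    using L.pow_eq_id[OF x(1), of k] x(2) by (simp add: L_pow) (simp add: L_def)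
  then have "ord x = n" using ord_unique[OF xN] by blast
  then show ?thesis using xN by blast
qed

end

theorem corollary3p4:
  fixes n :: nat
    and G :: "('a, 'c) monoid_scheme"
    and N :: "('b, 'd) monoid_scheme"
  assumes "n > 0" and "odd n" and "burnside_number (rad n)"
    and "group G" and "group N"
    and "order G = 2 * n" and "order N = 2 * n"
    and "realizable G N"
  shows "(\<exists>\<phi> \<in> hom (integer_mod_group 2) (AutoGroup (integer_mod_group n)).
            G \<cong> semidirect (integer_mod_group n) (integer_mod_group 2) \<phi>)
     \<longleftrightarrow> (\<exists>\<psi> \<in> hom (integer_mod_group 2) (AutoGroup (integer_mod_group n)).
            N \<cong> semidirect (integer_mod_group n) (integer_mod_group 2) \<psi>)"
proof -
  obtain H where H: "regular_subgroup N H" and iso: "G \<cong> holomorph N\<lparr>carrier := H\<rparr>"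
    using assms(8) by (auto simp: realizable_def)
  have "card H = order N"
    using iso_same_card[OF iso] assms(6,7) by (simp add: order_def)
  then interpret regular_in_holomorph N H n
    using H assms(2,5,7) coprime_of_burnside_rad[OF assms(1,3)]
    by (simp add: regular_in_holomorph_def regular_in_holomorph_axioms_def)
  have "(\<exists>x\<in>carrier G. group.ord G x = n) \<longleftrightarrow> (\<exists>h\<in>H. R.ord h = n)"
    using iso_exists_ord[OF assms(4) group_R iso, of _ n]
      iso_exists_ord[OF group_R assms(4) group.iso_sym[OF assms(4) iso], of _ n] by auto
  also have "\<dots> \<longleftrightarrow> (\<exists>x\<in>carrier N. ord x = n)"
    using order_n_element_of_H order_n_element_of_N by blast
  finally show ?thesis
    unfolding semidirect_iff_element_of_order[OF assms(4,6,2)]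
      semidirect_iff_element_of_order[OF assms(5,7,2)] .
qed

end
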